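(* Consider the elastoplastic system $(D,A,\prod_j[c_j^-,c_j^+],R,l(t))$ and the associated objects $d$, $P$, $n_j$, $\mathcal{V}$, $\mathcal{V}_{basis}$, $c(t)$, $C$, $C(t)$, $L(\alpha,j)$, $\overline{\overline L}(\alpha,j)$ described in the context. Let $I_0\subset\{-1,1\}\times\{1,\dots,m\}$ be nonempty with $|I_0|<d$. Let $I_1\subset\{-1,1\}\times\{1,\dots,m\}$ satisfy $|I_0|+|I_1|=d$ and ${\rm rank}\big(P(\{\alpha e_j:(\alpha,j)\in I_0\cup I_1\})\big)=d$, and let $I_1,\dots,I_M$, $M=2^{d-|I_0|}$, be all the distinct families obtained from $I_1$ by replacing any number of its elements $(\alpha,j)$ by $(-\alpha,j)$. Let $$F=\Big(\bigcap_{(\alpha,j)\in I_0}\overline{\overline L}(\alpha,j)\Big)\cap\Big(\bigcap_{i=1}^M\bigcap_{(\alpha,j)\in I_i}L(\alpha,j)\Big),\qquad F(t)=F+c(t),$$ and let $y_{*,i}$ be the unique $y\in\mathcal{V}$ with $\langle e_j,Ay\rangle=c_j^\alpha$ for all $(\alpha,j)\in I_0\cup I_i$, $i=1,\dots,M$. Let $\tau_d>0$ and assume that $$\begin{pmatrix}1\\0_{m-n+1}\end{pmatrix}l'(t)\in{\rm cone}\big(P\{\alpha e_j:(\alpha,j)\in I_0\}\big)\quad\text{for a.a. }t\in[0,\tau_d],$$ and that $c_j^-<\langle e_j,Ay_{*,i}\rangle<c_j^+$ for all $i\in\{1,\dots,M\}$ and every $j$ not occurring in $I_0\cup I_1\cup\dots\cup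 I_M$. Let $\varepsilon_0>0$ satisfy $\varepsilon_0\le\bar\varepsilon_0(t)$ for a.a. $t\in[0,\tau_d]$, where $$\bar\varepsilon_0(t)=\min_{(\alpha_*,j_* )\in I_0}{\rm dist}^A\Big(-c'(t),\,{\rm span}\{n_j:(\alpha,j)\in I_0\setminus\{(\alpha_*,j_* )\}\}\Big),$$ and let $\sigma_i$ be the largest eigenvalue of $\big(\sqrt A\mathcal{L}_i\sqrt{A^{-1}}\big)^T\sqrt A\mathcal{L}_i\sqrt{A^{-1}}$, where $\mathcal{L}_i$ is the $m\times m$-matrix $$\mathcal{L}_i=\big(\{n_j,(\alpha,j)\in I_0\}\big)\Big[\big(P(\{e_j,(\alpha,j)\in I_0\},\{e_j,(\alpha,j)\in I_i\})\big)^{-1}\Big]_{|I_0|}P .$$ If $$\tau_d\ge\frac{\max\{\sqrt{\sigma_1},\dots,\sqrt{\sigma_M}\}}{\varepsilon_0}\cdot\|A^{-1}c^+-A^{-1}c^-\|^A,$$ then, with $\varepsilon=\varepsilon_0/\max_i\sqrt{\sigma_i}$, $$-\dot c(t)+B^A_{\varepsilon}(0)\cap N^A_F(y)\subset N^A_C(y)\quad\text{for all }y\in F\text{ and a.a. }t\in[0,\tau_d],$$ and, in particular, the solutions $y$ of the sweeping process $-\dot y(t)\in N^A_{C(t)}(y(t))$ with any initial conditions $y(0)\in C(0)$ satisfy $y(\tau_d)\in F(\tau_d)$. Accordingly, the stress vector $s(t)$ of the elastoplastic system satisfies $s(\tau_d)\in{\rm conv}\{Ay_{*,1},\dots,Ay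_{*,M}\}$.
   Context: Setting: $m\ge n\ge2$; $D$ is an $m\times n$ matrix (kinematic matrix of a connected network of $m$ springs on $n$ nodes) with ${\rm rank}\,D=n-1$; $A={\rm diag}(a_1,\dots,a_m)$ with all $a_j>0$; $c_j^-\le c_j^+$ are the elastic limits of spring $j$, $c^\pm=(c_1^\pm,\dots,c_m^\pm)^T$; $R\in\mathbb{R}^m$ with ${\rm rank}(D^TR)=1$; $l:[0,\infty)\to\mathbb{R}$ is the Lipschitz displacement-controlled loading. Put $d=m-n+2$. Choose: an $n\times(n-2)$-matrix $Q$ with ${\rm rank}(DQ)=n-2$ and $R^TDQ=0$; an $m\times d$-matrix $\mathcal{V}_{basis}$ with linearly independent columns and $(DQ)^TA\mathcal{V}_{basis}=0$; an $m\times(m-n+1)$-matrix $D^\perp$ of rank $m-n+1$ with $(D^\perp)^TD=0$. Let $P=\begin{pmatrix}R^T\\(D^\perp)^T\end{pmatrix}$ ($d\times m$), $W=P\,\mathcal{V}_{basis}$ (invertible $d\times d$), $\mathcal{V}=\mathcal{V}_{basis}\mathbb{R}^d$ with scalar product $(x,y)_A=\langle x,Ay\rangle$, $n_j=\mathcal{V}_{basis}W^{-1}Pe_j$ (one has $\langle e_j,Ay\rangle=\langle n_j,Ay\rangle$ for $y\in\mathcal{V}$), and $c(t)=-\mathcal{V}_{basis}W^{-1}\begin{pmatrix}1\\0_{m-n+1}\end{pmatrix}l(t)$. With $e_j$ the standard basis of $\mathbb{R}^m$ and $c_j^\alpha=c_j^{\pm}$ for $\alpha=\pm1$: $L(\alpha,j)=\{y\in\mathcal{V}:\langle\alpha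 e_j,Ay\rangle\le\alpha c_j^\alpha\}$, $\overline{\overline L}(\alpha,j)=\{y\in\mathcal{V}:\langle e_j,Ay\rangle=c_j^\alpha\}$, $C=\{y\in\mathcal{V}:c_j^-\le\langle e_j,Ay\rangle\le c_j^+,\ j=1,\dots,m\}$, $C(t)=C+c(t)$. A solution of the sweeping process is a locally absolutely continuous $y:[0,\infty)\to\mathcal{V}$ with $y(t)\in C(t)$ for all $t$ satisfying the inclusion a.e. The stress vector is $s(t)=A(y(t)-c(t))$. $(\{v_k\})$ denotes the matrix with columns $v_k$; $[X]_k$ is the matrix formed by the first $k$ rows of $X$; ${\rm cone}(S)$ is the set of nonnegative linear combinations of elements of $S$. $\|x\|^A=\sqrt{\langle x,Ax\rangle}$, ${\rm dist}^A$ is the distance in this norm (with ${\rm span}\,\emptyset=\{0\}$); $B^A_\varepsilon(0)=\{x\in\mathcal{V}:\|x\|^A\le\varepsilon\}$; for closed convex $K\subset\mathcal{V}$, $N^A_K(y)=\{x\in\mathcal{V}:\langle x,A(\xi-y)\rangle\le0\ \forall\xi\in K\}$ if $y\in K$ and $\emptyset$ otherwise. *)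

theory Defs
  imports "HOL-Analysis.Analysis"
begin

definition diag_matrix :: "real^'m \<Rightarrow> real^'m^'m" where
  "diag_matrix v = (\<chi> i j. if i = j then v $ i else 0)"

definition eigenvalues :: "real^'m^'m \<Rightarrow> real set" where
  "eigenvalues T = {\<mu>. \<exists>v. v \<noteq> 0 \<and> T *v v = \<mu> *\<^sub>R v}"

(* A division is a finite family of compact intervals [Inf k, Sup k] with pairwise disjoint
   interiors; measure lborel k is the length of k. *)
definition abs_cont_on_interval :: "real \<Rightarrow> real \<Rightarrow> (real \<Rightarrow> 'a::real_normed_vector) \<Rightarrow> bool" where
  "abs_cont_on_interval a b f \<longleftrightarrow>
     (\<forall>\<epsilon>>0. \<exists>\<delta>>0. \<forall>\<D>. \<D> division_of \<Union>\<D> \<and> \<Union>\<D> \<subseteq> {a..b} \<and> (\<Sum>k\<in>\<D>. measure lborel k) < \<delta>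
        \<longrightarrow> (\<Sum>k\<in>\<D>. norm (f (Sup k) - f (Inf k))) < \<epsilon>)"

(* Springs are indexed by 'm and nodes by 'n, so m = CARD('m) and n = CARD('n); the columns of
   the matrix Dperp are indexed by 'p, with CARD('p) = m - n + 1, and d = CARD('p option).
   The matrix Q has n - 2 columns, possibly none, whereas index types are never empty: it is
   therefore represented by its columns Q_col 0, ..., Q_col (n - 3).
   The field a_diag holds the diagonal of the stiffness matrix A. *)
record ('m::finite, 'n::finite, 'p::finite) elastoplastic =
  D_mat :: "real^'n^'m"
  a_diag :: "real^'m"
  c_minus :: "real^'m"
  c_plus :: "real^'m"
  R_vec :: "real^'m"
  load :: "real \<Rightarrow> real"
  Q_col :: "nat \<Rightarrow> real^'n"
  V_basis :: "real^('p option)^'m"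
  Dperp :: "real^'p^'m"

definition A_mat :: "('m::finite, 'n::finite, 'p::finite) elastoplastic \<Rightarrow> real^'m^'m" where
  "A_mat E = diag_matrix (a_diag E)"

definition elastoplastic_system :: "('m::finite, 'n::finite, 'p::finite) elastoplastic \<Rightarrow> bool" where
  "elastoplastic_system E \<longleftrightarrow>
     2 \<le> CARD('n) \<and> CARD('n) \<le> CARD('m) \<and> CARD('p) = CARD('m) - CARD('n) + 1 \<and>
     rank (D_mat E) = CARD('n) - 1 \<and>
     (\<forall>j. 0 < a_diag E $ j) \<and>
     (\<forall>j. c_minus E $ j \<le> c_plus E $ j) \<and>
     rank (transpose (D_mat E) ** (columnvector (R_vec E) :: real^1^'m)) = 1 \<and>
     (\<exists>K. K-lipschitz_on {0..} (load E)) \<and>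
     dim ((\<lambda>k. D_mat E *v Q_col E k) ` {..<CARD('n) - 2}) = CARD('n) - 2 \<and>
     (\<forall>k<CARD('n) - 2. R_vec E \<bullet> (D_mat E *v Q_col E k) = 0) \<and>
     inj (\<lambda>k. column k (V_basis E)) \<and> independent (columns (V_basis E)) \<and>
     (\<forall>k<CARD('n) - 2. \<forall>i.
        (D_mat E *v Q_col E k) \<bullet> (A_mat E *v column i (V_basis E)) = 0) \<and>
     rank (Dperp E) = CARD('p) \<and>
     transpose (Dperp E) ** D_mat E = 0"

(* Row None is R_vec, the remaining rows are those of the transpose of Dperp. Hence axis None 1 is
   the vector (1, 0, ..., 0). *)
definition P_mat :: "('m::finite, 'n::finite, 'p::finite) elastoplastic \<Rightarrow> real^'m^('p option)" where
  "P_mat E = (\<chi> r. case r of None \<Rightarrow> R_vec E | Some k \<Rightarrow> column k (Dperp E))"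

definition W_mat ::
    "('m::finite, 'n::finite, 'p::finite) elastoplastic \<Rightarrow> real^('p option)^('p option)" where
  "W_mat E = P_mat E ** V_basis E"

definition V_space :: "('m::finite, 'n::finite, 'p::finite) elastoplastic \<Rightarrow> (real^'m) set" where
  "V_space E = range ((*v) (V_basis E))"

definition n_vec :: "('m::finite, 'n::finite, 'p::finite) elastoplastic \<Rightarrow> 'm \<Rightarrow> real^'m" where
  "n_vec E j = (V_basis E ** matrix_inv (W_mat E) ** P_mat E) *v axis j 1"

definition c_shift :: "('m::finite, 'n::finite, 'p::finite) elastoplastic \<Rightarrow> real \<Rightarrow> real^'m" where
  "c_shift E t = - (load E t *\<^sub>R ((V_basis E ** matrix_inv (W_mat E)) *v axis None 1))"

(* c_j^alpha for alpha in {-1, 1} *)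
definition c_lim ::
    "('m::finite, 'n::finite, 'p::finite) elastoplastic \<Rightarrow> real \<Rightarrow> 'm \<Rightarrow> real" where
  "c_lim E \<alpha> j = (if \<alpha> = 1 then c_plus E $ j else c_minus E $ j)"

definition L_half ::
    "('m::finite, 'n::finite, 'p::finite) elastoplastic \<Rightarrow> real \<times> 'm \<Rightarrow> (real^'m) set" where
  "L_half E = (\<lambda>(\<alpha>, j). {y \<in> V_space E. (\<alpha> *\<^sub>R axis j 1) \<bullet> (A_mat E *v y) \<le> \<alpha> * c_lim E \<alpha> j})"

definition L_plane ::
    "('m::finite, 'n::finite, 'p::finite) elastoplastic \<Rightarrow> real \<times> 'm \<Rightarrow> (real^'m) set" where
  "L_plane E = (\<lambda>(\<alpha>, j). {y \<in> V_space E. axis j 1 \<bullet> (A_mat E *v y) = c_lim E \<alpha> j})"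

definition C_set :: "('m::finite, 'n::finite, 'p::finite) elastoplastic \<Rightarrow> (real^'m) set" where
  "C_set E = {y \<in> V_space E.
     \<forall>j. c_minus E $ j \<le> axis j 1 \<bullet> (A_mat E *v y) \<and> axis j 1 \<bullet> (A_mat E *v y) \<le> c_plus E $ j}"

definition moved ::
    "('m::finite, 'n::finite, 'p::finite) elastoplastic \<Rightarrow> (real^'m) set \<Rightarrow> real \<Rightarrow> (real^'m) set" where
  "moved E K t = (\<lambda>y. y + c_shift E t) ` K"

definition norm_A :: "('m::finite, 'n::finite, 'p::finite) elastoplastic \<Rightarrow> real^'m \<Rightarrow> real" where
  "norm_A E x = sqrt (x \<bullet> (A_mat E *v x))"

definition dist_A ::
    "('m::finite, 'n::finite, 'p::finite) elastoplastic \<Rightarrow> real^'m \<Rightarrow> (real^'m) set \<Rightarrow> real" where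
  "dist_A E x S = (INF z\<in>S. norm_A E (x - z))"

definition ball_A :: "('m::finite, 'n::finite, 'p::finite) elastoplastic \<Rightarrow> real \<Rightarrow> (real^'m) set" where
  "ball_A E \<epsilon> = {x \<in> V_space E. norm_A E x \<le> \<epsilon>}"

definition normal_cone_A ::
    "('m::finite, 'n::finite, 'p::finite) elastoplastic \<Rightarrow> (real^'m) set \<Rightarrow> real^'m \<Rightarrow> (real^'m) set" where
  "normal_cone_A E K y =
     (if y \<in> K then {x \<in> V_space E. \<forall>\<xi>\<in>K. x \<bullet> (A_mat E *v (\<xi> - y)) \<le> 0} else {})"

definition sweeping_solution ::
    "('m::finite, 'n::finite, 'p::finite) elastoplastic \<Rightarrow> (real \<Rightarrow> real^'m) \<Rightarrow> bool" where
  "sweeping_solution E y \<longleftrightarrow>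
     (\<forall>t\<ge>0. y t \<in> V_space E) \<and>
     (\<forall>T\<ge>0. abs_cont_on_interval 0 T y) \<and>
     (\<forall>t\<ge>0. y t \<in> moved E (C_set E) t) \<and>
     (AE t in lebesgue. 0 \<le> t \<longrightarrow>
        (\<exists>y'. (y has_vector_derivative y') (at t) \<and>
              - y' \<in> normal_cone_A E (moved E (C_set E) t) (y t)))"

definition stress ::
    "('m::finite, 'n::finite, 'p::finite) elastoplastic \<Rightarrow> (real \<Rightarrow> real^'m) \<Rightarrow> real \<Rightarrow> real^'m" where
  "stress E y t = A_mat E *v (y t - c_shift E t)"

definition sign_changes :: "(real \<times> 'm) set \<Rightarrow> (real \<times> 'm) set set" where
  "sign_changes J = {(J - S) \<union> (\<lambda>(\<alpha>, j). (- \<alpha>, j)) ` S | S. S \<subseteq> J}"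

definition F_set ::
    "('m::finite, 'n::finite, 'p::finite) elastoplastic \<Rightarrow> (real \<times> 'm) set \<Rightarrow>
     (nat \<Rightarrow> (real \<times> 'm) set) \<Rightarrow> nat \<Rightarrow> (real^'m) set" where
  "F_set E I\<^sub>0 I M = (\<Inter>p\<in>I\<^sub>0. L_plane E p) \<inter> (\<Inter>i\<in>{1..M}. \<Inter>p\<in>I i. L_half E p)"

definition y_star ::
    "('m::finite, 'n::finite, 'p::finite) elastoplastic \<Rightarrow> (real \<times> 'm) set \<Rightarrow> (real \<times> 'm) set \<Rightarrow> real^'m" where
  "y_star E I\<^sub>0 J =
     (THE y. y \<in> V_space E \<and> (\<forall>(\<alpha>, j)\<in>I\<^sub>0 \<union> J. axis j 1 \<bullet> (A_mat E *v y) = c_lim E \<alpha> j))"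

definition eps_bar ::
    "('m::finite, 'n::finite, 'p::finite) elastoplastic \<Rightarrow> (real \<times> 'm) set \<Rightarrow> real \<Rightarrow> real" where
  "eps_bar E I\<^sub>0 t =
     Min ((\<lambda>p. dist_A E (- vector_derivative (c_shift E) (at t))
                        (span ((\<lambda>(\<alpha>, j). n_vec E j) ` (I\<^sub>0 - {p})))) ` I\<^sub>0)"

(* e is an enumeration of the union of I_0 and I_i; it fixes the order of the columns of
   P ({e_j : I_0}, {e_j : I_i}). The indices k with e k in I_0 are the leading ones, so the sum
   over them is the product of the matrix of the n_j, (alpha, j) in I_0, with the first |I_0|
   rows of the inverse (times P). The result does not depend on e. *)
definition L_mat ::
    "('m::finite, 'n::finite, 'p::finite) elastoplastic \<Rightarrow> (real \<times> 'm) set \<Rightarrow>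
     ('p option \<Rightarrow> real \<times> 'm) \<Rightarrow> real^'m^'m" where
  "L_mat E I\<^sub>0 e =
     (let G = P_mat E ** (\<chi> r k. axis (snd (e k)) 1 $ r)
      in \<chi> i j. \<Sum>k | e k \<in> I\<^sub>0. n_vec E (snd (e k)) $ i * (matrix_inv G ** P_mat E) $ k $ j)"

definition sigma_max ::
    "('m::finite, 'n::finite, 'p::finite) elastoplastic \<Rightarrow> (real \<times> 'm) set \<Rightarrow>
     ('p option \<Rightarrow> real \<times> 'm) \<Rightarrow> real" where
  "sigma_max E I\<^sub>0 e =
     (let S = diag_matrix (\<chi> j. sqrt (a_diag E $ j)) ** L_mat E I\<^sub>0 e **
              diag_matrix (\<chi> j. sqrt (inverse (a_diag E $ j)))
      in Max (eigenvalues (transpose S ** S)))"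

end

theory Submission
  imports Defs
begin

text \<open>
  Write \<open>x = y - c\<close> for a solution \<open>y\<close>. The inclusion gives \<open>\<langle>x' + c', A(x - \<xi>)\<rangle> \<le> 0\<close> for all
  \<open>\<xi> \<in> C\<close>. Let \<open>\<xi>\<close> be the nearest point of \<open>F\<close>, so that \<open>\<eta> = \<epsilon> (x - \<xi>) / \<parallel>x - \<xi>\<parallel>\<close> lies in the ball and in the
  normal cone of \<open>F\<close> at \<open>\<xi>\<close>; then \<open>- c' + \<eta>\<close> is normal to \<open>C\<close> at \<open>\<xi>\<close>, and the two inequalities together
  show that the distance from \<open>x\<close> to \<open>F\<close> decreases at a rate of at least \<open>\<epsilon>\<close>. Initially this distance is at most the
  diameter bound \<open>\<parallel>A\<^sup>-\<^sup>1 c\<^sup>+ - A\<^sup>-\<^sup>1 c\<^sup>-\<parallel>\<close>, hence it vanishes at time \<open>\<tau>\<close>.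

  For the inclusion of the shifted cone, use the basis \<open>n\<^sub>j\<close>, \<open>j\<close> from \<open>I\<^sub>0 \<union> I\<^sub>1\<close>, of \<open>V\<close>. In the dual coordinates,
  the stresses, \<open>F\<close> is a box with the vertices \<open>y\<^sub>*\<^sub>i\<close>. The coefficients of \<open>- c'\<close> at the \<open>\<alpha> n\<^sub>j\<close>
  from \<open>I\<^sub>0\<close> are nonnegative, and a normal vector of \<open>F\<close> can have coefficients of the wrong sign only there; the
  bounds by \<open>\<epsilon>\<^sub>0\<close> and \<open>\<sigma>\<close> keep the sums nonnegative.
\<close>

section \<open>Absolutely continuous functions\<close>

lemma negligible_outer_open:
  fixes N :: "real set"
  assumes "negligible N" "\<delta> > 0"
  obtains U where "open U" "N \<subseteq> U" "U \<in> lmeasurable" "measure lebesgue U < \<delta>"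
proof -
  have N: "N \<in> null_sets lebesgue" using assms(1) negligible_iff_null_sets by blast
  obtain U where U: "open U" "N \<subseteq> U" "U - N \<in> lmeasurable" "emeasure lebesgue (U - N) < ennreal \<delta>"
    using sets_lebesgue_outer_open[of N \<delta>] assms N by (metis null_setsD2)
  have eq: "emeasure lebesgue U = emeasure lebesgue (U - N)"
    using U(1) N by (simp add: emeasure_Diff_null_set)
  have "U \<in> lmeasurable"
    using U(1,4) eq by (simp add: fmeasurable_def) (metis ennreal_less_top less_trans)
  moreover have "measure lebesgue U < \<delta>"
    using U(4) eq assms(2) unfolding measure_def
    by (metis enn2real_less_iff ennreal_enn2real ennreal_less_iff ennreal_less_top enn2real_nonneg less_trans)
  ultimately show ?thesis using that U by blast
qed

lemma abs_cont_on_interval_subset: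
  assumes "abs_cont_on_interval a b f" "a \<le> a'" "b' \<le> b"
  shows "abs_cont_on_interval a' b' f"
proof -
  have "{a'..b'} \<subseteq> {a..b}" using assms(2,3) by auto
  then show ?thesis
    using assms(1) unfolding abs_cont_on_interval_def by (meson subset_trans)
qed

text \<open>A null set of exceptional points is handled by absolute continuity on the intervals of a
  fine tagged division whose tags lie in it.\<close>

lemma abs_cont_nonincreasing:
  fixes f :: "real \<Rightarrow> real"
  assumes ac: "abs_cont_on_interval a b f" and "a \<le> b" and N: "negligible N"
    and der: "\<And>t. t \<in> {a..b} - N \<Longrightarrow> \<exists>D. (f has_vector_derivative D) (at t) \<and> D \<le> 0"
  shows "f b \<le> f a"
proof (rule field_le_epsilon)
  fix e :: real assume "e > 0"
  define \<eta> where "\<eta> = e / (1 + (b - a))"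
  have \<eta>: "\<eta> > 0" "\<eta> * (1 + (b - a)) = e" using \<open>e > 0\<close> \<open>a \<le> b\<close> by (auto simp: \<eta>_def)
  obtain \<delta> where \<delta>: "\<delta> > 0"
    and \<delta>': "\<And>\<D>. \<D> division_of \<Union>\<D> \<Longrightarrow> \<Union>\<D> \<subseteq> {a..b} \<Longrightarrow> (\<Sum>k\<in>\<D>. measure lborel k) < \<delta>
        \<Longrightarrow> (\<Sum>k\<in>\<D>. norm (f (Sup k) - f (Inf k))) < \<eta>"
    using ac \<eta>(1) unfolding abs_cont_on_interval_def by meson
  obtain U where U: "open U" "N \<subseteq> U" "U \<in> lmeasurable" "measure lebesgue U < \<delta>"
    using negligible_outer_open[OF N \<delta>] by metis
  \<comment> \<open>A straddle estimate: since \<open>u\<close> and \<open>v\<close> lie on either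
    side of \<open>t\<close>, the two errors measured from \<open>t\<close> add up to
    \<open>\<eta>\<close> times the length, and the nonpositive derivative only helps.\<close>
  have "\<exists>r>0. \<forall>u v. t - r < u \<and> u \<le> t \<and> t \<le> v \<and> v < t + r \<longrightarrow> f v - f u \<le> \<eta> * (v - u)"
    if "t \<in> {a..b} - N" for t
  proof -
    obtain D where D: "(f has_vector_derivative D) (at t)" "D \<le> 0" using der \<open>t \<in> _\<close> by blast
    then have "(f has_derivative (\<lambda>h. h * D)) (at t)"
      by (simp add: has_vector_derivative_def)
    then obtain r where r: "r > 0" "\<And>s. \<bar>s - t\<bar> < r \<Longrightarrow> \<bar>f s - f t - (s - t) * D\<bar> \<le> \<eta> * \<bar>s - t\<bar>"
      unfolding has_derivative_within_alt using \<eta>(1) by (metis real_norm_def UNIV_I)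
    have "f v - f u \<le> \<eta> * (v - u)" if "t - r < u" "u \<le> t" "t \<le> v" "v < t + r" for u v
    proof -
      have "f v - f t \<le> \<eta> * (v - t) + (v - t) * D" "f t - f u \<le> \<eta> * (t - u) + (t - u) * D"
        using r(2)[of v] r(2)[of u] that by (auto simp: abs_le_iff algebra_simps)
      moreover have "(v - t) * D \<le> 0" "(t - u) * D \<le> 0"
        using that D(2) by (auto intro: mult_nonneg_nonpos)
      ultimately show ?thesis by (simp add: algebra_simps)
    qed
    then show ?thesis using r(1) by blast
  qed
  then obtain r where r: "\<And>t. t \<in> {a..b} - N \<Longrightarrow> r t > 0"
    and straddle: "\<And>t u v. t \<in> {a..b} - N \<Longrightarrow> t - r t < u \<Longrightarrow> u \<le> t \<Longrightarrow> t \<le> v \<Longrightarrow> v < t + r t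
          \<Longrightarrow> f v - f u \<le> \<eta> * (v - u)"
    by metis
  \<comment> \<open>A tag in \<open>N\<close> forces its interval into \<open>U\<close>, of measure
    below \<open>\<delta>\<close>; any other tag in \<open>{a..b}\<close> forces it into the
    straddle radius. The unit ball elsewhere only makes \<open>g\<close> a gauge on the whole
    line.\<close>
  define g where "g t = (if t \<in> N then U else if t \<in> {a..b} then ball t (r t) else ball t 1)" for t
  have "gauge g" unfolding gauge_def g_def using U r by auto
  then obtain p where p: "p tagged_division_of {a..b}" "g fine p"
    by (rule fine_division_exists_real)
  define q where "q = {(x, k) \<in> p. x \<in> N}"
  have "q \<subseteq> p" by (auto simp: q_def)
  have finp: "finite p" using p(1) by blast
  have q: "q tagged_partial_division_of {a..b}"
    using p(1) \<open>q \<subseteq> p\<close> by (meson tagged_division_of_def tagged_partial_division_subset)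
  have qU: "q tagged_division_of \<Union>(snd ` q)" by (rule tagged_partial_division_of_Union_self[OF q])
  have qdiv: "snd ` q division_of \<Union>(snd ` q)" by (rule division_of_tagged_division[OF qU])
  have in_ab: "k \<subseteq> {a..b}" "x \<in> k" "\<exists>u v. k = {u..v} \<and> u \<le> v" if xk: "(x, k) \<in> p" for x k
  proof -
    show "x \<in> k" "k \<subseteq> {a..b}" using tagged_division_ofD(2,3)[OF p(1) xk] by auto
    obtain u v where "k = cbox u v" using tagged_division_ofD(4)[OF p(1) xk] by blast
    then have uv: "k = {u..v}" by simp
    with \<open>x \<in> k\<close> have "u \<le> v" by auto
    with uv show "\<exists>u v. k = {u..v} \<and> u \<le> v" by blast
  qed
  have "\<Union>(snd ` q) \<subseteq> U"
  proof
    fix z assume "z \<in> \<Union>(snd ` q)"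
    then obtain x k where "(x, k) \<in> p" "x \<in> N" "z \<in> k" by (auto simp: q_def)
    then show "z \<in> U" using fineD[OF p(2), of x k] by (auto simp: g_def)
  qed
  moreover have "(\<Sum>k\<in>snd ` q. measure lborel k) = measure lebesgue (\<Union>(snd ` q))"
  proof -
    have "measure lborel k = measure lebesgue k" if k: "k \<in> snd ` q" for k
    proof -
      obtain x where "(x, k) \<in> p" using k \<open>q \<subseteq> p\<close> by auto
      then obtain u v where "k = {u..v}" using in_ab(3) by blast
      then show ?thesis by (simp add: measure_completion)
    qed
    then show ?thesis using content_division[OF qdiv] by simp
  qed
  moreover have "measure lebesgue (\<Union>(snd ` q)) \<le> measure lebesgue U"
    using \<open>\<Union>(snd ` q) \<subseteq> U\<close> U(3) qdiv by (meson fmeasurableD lmeasurable_division measure_mono_fmeasurable)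
  ultimately have small: "(\<Sum>k\<in>snd ` q. measure lborel k) < \<delta>" using U(4) by linarith
  have "\<Union>(snd ` q) \<subseteq> {a..b}" using in_ab(1) \<open>q \<subseteq> p\<close> by force
  then have bnd: "(\<Sum>k\<in>snd ` q. norm (f (Sup k) - f (Inf k))) < \<eta>" using \<delta>'[OF qdiv _ small] by blast
  \<comment> \<open>Passing from a sum over tagged pairs to a sum over intervals requires a function
    that vanishes on every degenerate interval. This includes the empty one, where
    \<open>Sup\<close> and \<open>Inf\<close> carry no meaning, hence the value 0.\<close>
  define h where "h k = (if k = {} then 0 else norm (f (Sup k) - f (Inf k)))" for k
  have h: "h k = norm (f (Sup k) - f (Inf k))" if "(x, k) \<in> p" for x k
    using in_ab(2)[OF that] by (auto simp: h_def)
  have "(\<Sum>(x, k)\<in>q. f (Sup k) - f (Inf k)) \<le> (\<Sum>(x, k)\<in>q. h k)"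
  proof (rule sum_mono, clarify)
    fix x k assume "(x, k) \<in> q"
    then have "(x, k) \<in> p" using \<open>q \<subseteq> p\<close> by blast
    then show "f (Sup k) - f (Inf k) \<le> h k" using h by (metis norm_ge_zero abs_ge_self real_norm_def)
  qed
  also have "\<dots> = (\<Sum>k\<in>snd ` q. h k)"
  proof (rule sum.over_tagged_division_lemma[OF qU])
    fix u v :: real assume "box u v = {}"
    then have "v \<le> u" by simp
    then show "h (cbox u v) = 0" by (cases "u = v") (auto simp: h_def)
  qed
  also have "\<dots> = (\<Sum>k\<in>snd ` q. norm (f (Sup k) - f (Inf k)))"
  proof (rule sum.cong[OF refl])
    fix k assume "k \<in> snd ` q"
    then obtain x where "(x, k) \<in> p" using \<open>q \<subseteq> p\<close> by auto
    then show "h k = norm (f (Sup k) - f (Inf k))" by (rule h)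
  qed
  finally have 1: "(\<Sum>(x, k)\<in>q. f (Sup k) - f (Inf k)) \<le> \<eta>"
    using bnd by linarith
  have "(\<Sum>(x, k)\<in>p - q. f (Sup k) - f (Inf k)) \<le> (\<Sum>(x, k)\<in>p - q. \<eta> * measure lborel k)"
  proof (rule sum_mono, clarify)
    fix x k assume xk: "(x, k) \<in> p" "(x, k) \<notin> q"
    then have "x \<notin> N" by (auto simp: q_def)
    have x: "x \<in> {a..b} - N" using in_ab(1,2) xk(1) \<open>x \<notin> N\<close> by blast
    obtain u v where k: "k = {u..v}" "u \<le> v" using in_ab(3)[OF xk(1)] by blast
    have "k \<subseteq> ball x (r x)" using fineD[OF p(2) xk(1)] x by (simp add: g_def)
    then have "u \<in> ball x (r x)" "v \<in> ball x (r x)" using k by auto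
    then have "f v - f u \<le> \<eta> * (v - u)"
      using straddle[OF x, of u v] in_ab(2)[OF xk(1)] k by (auto simp: dist_real_def)
    then show "f (Sup k) - f (Inf k) \<le> \<eta> * measure lborel k" using k by simp
  qed
  also have "\<dots> \<le> (\<Sum>(x, k)\<in>p. \<eta> * measure lborel k)"
  proof (rule sum_mono2[OF finp])
    show "0 \<le> (case z of (x, k) \<Rightarrow> \<eta> * measure lborel k)" for z :: "real \<times> real set"
      using \<eta>(1) by (cases z) simp
  qed auto
  also have "\<dots> = \<eta> * (b - a)"
  proof -
    have "(\<Sum>(x, k)\<in>p. measure lborel k) = b - a"
      using additive_content_tagged_division[of p a b] p(1) \<open>a \<le> b\<close> by simp
    moreover have "(\<Sum>(x, k)\<in>p. \<eta> * measure lborel k) = \<eta> * (\<Sum>(x, k)\<in>p. measure lborel k)"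
      by (simp add: sum_distrib_left case_prod_unfold)
    ultimately show ?thesis by simp
  qed
  finally have 2: "(\<Sum>(x, k)\<in>p - q. f (Sup k) - f (Inf k)) \<le> \<eta> * (b - a)" .
  have "f b - f a = (\<Sum>(x, k)\<in>p. f (Sup k) - f (Inf k))"
    using additive_tagged_division_1[OF \<open>a \<le> b\<close> p(1), of f] by simp
  also have "\<dots> = (\<Sum>(x, k)\<in>p - q. f (Sup k) - f (Inf k)) + (\<Sum>(x, k)\<in>q. f (Sup k) - f (Inf k))"
    by (rule sum.subset_diff[OF \<open>q \<subseteq> p\<close> finp])
  also have "\<dots> \<le> \<eta> * (1 + (b - a))" using 1 2 by (simp add: algebra_simps)
  finally show "f b \<le> f a + e" using \<eta>(2) by simp
qed

lemma abs_cont_lipschitz_compose: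
  assumes "abs_cont_on_interval a b f"
    and L: "\<And>x y. norm (g x - g y) \<le> L * norm (x - y)"
  shows "abs_cont_on_interval a b (\<lambda>t. g (f t))"
  unfolding abs_cont_on_interval_def
proof (intro allI impI)
  fix e :: real assume "e > 0"
  \<comment> \<open>The added 1 keeps \<open>K\<close> positive, so that the tolerance
    \<open>e / K\<close> makes sense for every \<open>L\<close>.\<close>
  define K where "K = \<bar>L\<bar> + 1"
  have "K > 0" by (simp add: K_def)
  then have eK: "e / K > 0" using \<open>e > 0\<close> by simp
  have K: "norm (g x - g y) \<le> K * norm (x - y)" for x y
    using order_trans[OF L mult_right_mono[of L K "norm (x - y)"]] by (simp add: K_def)
  obtain \<delta> where \<delta>: "\<delta> > 0" "\<And>\<D>. \<D> division_of \<Union>\<D> \<Longrightarrow> \<Union>\<D> \<subseteq> {a..b} \<Longrightarrow> (\<Sum>k\<in>\<D>. measure lborel k) < \<delta>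
        \<Longrightarrow> (\<Sum>k\<in>\<D>. norm (f (Sup k) - f (Inf k))) < e / K"
    using assms(1) eK unfolding abs_cont_on_interval_def by meson
  have "(\<Sum>k\<in>\<D>. norm (g (f (Sup k)) - g (f (Inf k)))) < e"
    if "\<D> division_of \<Union>\<D>" "\<Union>\<D> \<subseteq> {a..b}" "(\<Sum>k\<in>\<D>. measure lborel k) < \<delta>" for \<D>
  proof -
    have "(\<Sum>k\<in>\<D>. norm (g (f (Sup k)) - g (f (Inf k)))) \<le> K * (\<Sum>k\<in>\<D>. norm (f (Sup k) - f (Inf k)))"
      unfolding sum_distrib_left by (rule sum_mono) (rule K)
    also have "\<dots> < e" using \<delta>(2)[OF that] \<open>K > 0\<close> by (simp add: field_simps)
    finally show ?thesis .
  qed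
  then show "\<exists>\<delta>>0. \<forall>\<D>. \<D> division_of \<Union>\<D> \<and> \<Union>\<D> \<subseteq> {a..b} \<and> (\<Sum>k\<in>\<D>. measure lborel k) < \<delta>
        \<longrightarrow> (\<Sum>k\<in>\<D>. norm (g (f (Sup k)) - g (f (Inf k)))) < e"
    using \<delta>(1) by (intro exI[of _ \<delta>]) simp
qed

lemma abs_cont_add:
  assumes "abs_cont_on_interval a b f" "abs_cont_on_interval a b g"
  shows "abs_cont_on_interval a b (\<lambda>t. f t + g t)"
  unfolding abs_cont_on_interval_def
proof (intro allI impI)
  fix e :: real assume "e > 0"
  then have e2: "e / 2 > 0" by simp
  obtain \<delta>1 where \<delta>1: "\<delta>1 > 0" "\<And>\<D>. \<D> division_of \<Union>\<D> \<Longrightarrow> \<Union>\<D> \<subseteq> {a..b} \<Longrightarrow> (\<Sum>k\<in>\<D>. measure lborel k) < \<delta>1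
        \<Longrightarrow> (\<Sum>k\<in>\<D>. norm (f (Sup k) - f (Inf k))) < e / 2"
    using assms(1) e2 unfolding abs_cont_on_interval_def by meson
  obtain \<delta>2 where \<delta>2: "\<delta>2 > 0" "\<And>\<D>. \<D> division_of \<Union>\<D> \<Longrightarrow> \<Union>\<D> \<subseteq> {a..b} \<Longrightarrow> (\<Sum>k\<in>\<D>. measure lborel k) < \<delta>2
        \<Longrightarrow> (\<Sum>k\<in>\<D>. norm (g (Sup k) - g (Inf k))) < e / 2"
    using assms(2) e2 unfolding abs_cont_on_interval_def by meson
  have "(\<Sum>k\<in>\<D>. norm (f (Sup k) + g (Sup k) - (f (Inf k) + g (Inf k)))) < e"
    if \<D>: "\<D> division_of \<Union>\<D>" "\<Union>\<D> \<subseteq> {a..b}" "(\<Sum>k\<in>\<D>. measure lborel k) < min \<delta>1 \<delta>2" for \<D>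
  proof -
    have "(\<Sum>k\<in>\<D>. norm (f (Sup k) + g (Sup k) - (f (Inf k) + g (Inf k))))
      \<le> (\<Sum>k\<in>\<D>. norm (f (Sup k) - f (Inf k)) + norm (g (Sup k) - g (Inf k)))"
      by (rule sum_mono) (rule norm_diff_triangle_ineq)
    also have "\<dots> < e"
      using \<delta>1(2)[OF \<D>(1,2)] \<delta>2(2)[OF \<D>(1,2)] \<D>(3) by (simp add: sum.distrib)
    finally show ?thesis .
  qed
  then show "\<exists>\<delta>>0. \<forall>\<D>. \<D> division_of \<Union>\<D> \<and> \<Union>\<D> \<subseteq> {a..b} \<and> (\<Sum>k\<in>\<D>. measure lborel k) < \<delta>
        \<longrightarrow> (\<Sum>k\<in>\<D>. norm (f (Sup k) + g (Sup k) - (f (Inf k) + g (Inf k)))) < e"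
    using \<delta>1(1) \<delta>2(1) by (intro exI[of _ "min \<delta>1 \<delta>2"]) simp
qed

lemma abs_cont_lipschitz:
  assumes "K-lipschitz_on {a..b} f"
  shows "abs_cont_on_interval a b f"
  unfolding abs_cont_on_interval_def
proof (intro allI impI)
  fix e :: real assume "e > 0"
  have "K \<ge> 0" using assms lipschitz_on_nonneg by blast
  have "(\<Sum>k\<in>\<D>. norm (f (Sup k) - f (Inf k))) < e"
    if \<D>: "\<D> division_of \<Union>\<D>" "\<Union>\<D> \<subseteq> {a..b}" "(\<Sum>k\<in>\<D>. measure lborel k) < e / (K + 1)" for \<D>
  proof -
    have "norm (f (Sup k) - f (Inf k)) \<le> K * measure lborel k" if k: "k \<in> \<D>" for k
    proof -
      obtain u v where uv: "k = {u..v}" "u \<le> v"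
        using division_ofD(3,4)[OF \<D>(1) k] by (metis atLeastatMost_empty_iff cbox_interval)
      have "k \<subseteq> {a..b}" using \<D>(2) k by blast
      then have "u \<in> {a..b}" "v \<in> {a..b}" using uv by auto
      then show ?thesis using lipschitz_onD[OF assms, of v u] uv by (simp add: dist_norm)
    qed
    then have "(\<Sum>k\<in>\<D>. norm (f (Sup k) - f (Inf k))) \<le> K * (\<Sum>k\<in>\<D>. measure lborel k)"
      unfolding sum_distrib_left by (rule sum_mono)
    also have "\<dots> \<le> (K + 1) * (\<Sum>k\<in>\<D>. measure lborel k)"
      by (intro mult_right_mono) (auto intro: sum_nonneg)
    also have "\<dots> < e" using \<D>(3) \<open>K \<ge> 0\<close> by (simp add: field_simps)
    finally show ?thesis .
  qed
  then show "\<exists>\<delta>>0. \<forall>\<D>. \<D> division_of \<Union>\<D> \<and> \<Union>\<D> \<subseteq> {a..b} \<and> (\<Sum>k\<in>\<D>. measure lborel k) < \<delta>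
        \<longrightarrow> (\<Sum>k\<in>\<D>. norm (f (Sup k) - f (Inf k))) < e"
    using \<open>e > 0\<close> \<open>K \<ge> 0\<close> by (intro exI[of _ "e / (K + 1)"]) auto
qed

lemma abs_cont_imp_continuous_on:
  assumes "abs_cont_on_interval a b f"
  shows "continuous_on {a..b} f"
  unfolding continuous_on_iff
proof (intro ballI allI impI)
  fix t e :: real assume t: "t \<in> {a..b}" and "e > 0"
  then obtain \<delta> where \<delta>: "\<delta> > 0" "\<And>\<D>. \<D> division_of \<Union>\<D> \<Longrightarrow> \<Union>\<D> \<subseteq> {a..b} \<Longrightarrow> (\<Sum>k\<in>\<D>. measure lborel k) < \<delta>
        \<Longrightarrow> (\<Sum>k\<in>\<D>. norm (f (Sup k) - f (Inf k))) < e"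
    using assms unfolding abs_cont_on_interval_def by meson
  have *: "norm (f v - f u) < e" if "u \<in> {a..b}" "v \<in> {a..b}" "u \<le> v" "v - u < \<delta>" for u v
  proof -
    have "{cbox u v} division_of cbox u v" using that(3) by (intro division_of_self) simp
    then show ?thesis using \<delta>(2)[of "{{u..v}}"] that by simp
  qed
  have "dist (f s) (f t) < e" if "s \<in> {a..b}" "dist s t < \<delta>" for s
    using *[of s t] *[of t s] that t by (cases "s \<le> t") (auto simp: dist_norm norm_minus_commute)
  then show "\<exists>d>0. \<forall>x'\<in>{a..b}. dist x' t < d \<longrightarrow> dist (f x') (f t) < e"
    using \<delta>(1) by blast
qed

section \<open>Reaching a convex set in finite time\<close>

text \<open>The error of the linear approximation is trapped between 0 and
  \<open>(norm (y - x))\<^sup>2\<close>: from above by measuring \<open>y\<close> against the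
  nearest point of \<open>x\<close>, from below by the obtuse angle inequality. Squaring the
  distance gives differentiability at the points of \<open>F\<close> as well.\<close>

lemma has_derivative_infdist_sq:
  fixes F :: "'a::euclidean_space set"
  assumes F: "convex F" "closed F" and \<xi>: "\<xi> \<in> F" "infdist x F = dist x \<xi>"
  shows "((\<lambda>x. (infdist x F)\<^sup>2) has_derivative (\<lambda>h. 2 * ((x - \<xi>) \<bullet> h))) (at x)"
  unfolding has_derivative_at_alt
proof (intro conjI allI impI)
  show "bounded_linear (\<lambda>h. 2 * ((x - \<xi>) \<bullet> h))"
    by (intro bounded_linear_const_mult bounded_linear_inner_right)
  fix e :: real assume "e > 0"
  have obt: "(x - \<xi>) \<bullet> (\<zeta> - \<xi>) \<le> 0" if "\<zeta> \<in> F" for \<zeta>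
    using any_closest_point_dot[OF F \<xi>(1) that] infdist_le \<xi>(2) by metis
  have "norm ((infdist y F)\<^sup>2 - (infdist x F)\<^sup>2 - 2 * ((x - \<xi>) \<bullet> (y - x))) \<le> e * norm (y - x)"
    if y: "norm (y - x) < e" for y
  proof -
    obtain \<zeta> where \<zeta>: "\<zeta> \<in> F" "infdist y F = dist y \<zeta>"
      using infdist_attains_inf[OF F(2)] \<xi>(1) by blast
    have "(infdist y F)\<^sup>2 \<le> (norm (y - \<xi>))\<^sup>2"
      using infdist_le[OF \<xi>(1), of y] infdist_nonneg by (intro power_mono) (auto simp: dist_norm)
    also have "\<dots> = (infdist x F)\<^sup>2 + 2 * ((x - \<xi>) \<bullet> (y - x)) + (norm (y - x))\<^sup>2"
      unfolding \<xi>(2) dist_norm power2_norm_eq_inner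
      by (simp add: inner_diff_left inner_diff_right inner_commute)
    finally have up: "(infdist y F)\<^sup>2 - (infdist x F)\<^sup>2 - 2 * ((x - \<xi>) \<bullet> (y - x)) \<le> (norm (y - x))\<^sup>2"
      by simp
    \<comment> \<open>Expanding this square leaves the error to be bounded plus twice an inner
      product that \<open>obt\<close> makes nonpositive.\<close>
    have "0 \<le> (norm ((y - \<zeta>) - (x - \<xi>)))\<^sup>2" by simp
    also have "\<dots> = (infdist y F)\<^sup>2 - (infdist x F)\<^sup>2 - 2 * ((x - \<xi>) \<bullet> (y - x)) + 2 * ((x - \<xi>) \<bullet> (\<zeta> - \<xi>))"
      unfolding \<xi>(2) \<zeta>(2) dist_norm power2_norm_eq_inner
      by (simp add: inner_diff_left inner_diff_right inner_commute)
    finally have low: "0 \<le> (infdist y F)\<^sup>2 - (infdist x F)\<^sup>2 - 2 * ((x - \<xi>) \<bullet> (y - x))"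
      using obt[OF \<zeta>(1)] by simp
    have "(norm (y - x))\<^sup>2 \<le> e * norm (y - x)"
      unfolding power2_eq_square using y by (intro mult_right_mono) auto
    then show ?thesis using up low by simp
  qed
  then show "\<exists>d>0. \<forall>y. norm (y - x) < d \<longrightarrow>
      norm ((infdist y F)\<^sup>2 - (infdist x F)\<^sup>2 - 2 * ((x - \<xi>) \<bullet> (y - x))) \<le> e * norm (y - x)"
    using \<open>e > 0\<close> by blast
qed

lemma has_vector_derivative_infdist:
  fixes F :: "'a::euclidean_space set"
  assumes F: "convex F" "closed F" and \<xi>: "\<xi> \<in> F" "infdist (z t) F = dist (z t) \<xi>"
    and z: "(z has_vector_derivative z') (at t)" and pos: "infdist (z t) F > 0"
  shows "((\<lambda>s. infdist (z s) F) has_vector_derivative (z' \<bullet> (z t - \<xi>)) / norm (z t - \<xi>)) (at t)"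
proof -
  have "((\<lambda>s. (infdist (z s) F)\<^sup>2) has_derivative (\<lambda>h. 2 * ((z t - \<xi>) \<bullet> (h *\<^sub>R z')))) (at t)"
    using has_derivative_compose[OF z[unfolded has_vector_derivative_def] has_derivative_infdist_sq[OF F \<xi>]]
    by simp
  then have "((\<lambda>s. (infdist (z s) F)\<^sup>2) has_real_derivative 2 * ((z t - \<xi>) \<bullet> z')) (at t)"
    unfolding has_field_derivative_def by (rule has_derivative_eq_rhs) (auto simp: mult_ac)
  then have "((\<lambda>s. sqrt ((infdist (z s) F)\<^sup>2)) has_real_derivative
      inverse (sqrt ((infdist (z t) F)\<^sup>2)) / 2 * (2 * ((z t - \<xi>) \<bullet> z'))) (at t)"
    using pos by (intro DERIV_chain2[where f = sqrt] DERIV_real_sqrt) auto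
  moreover have "inverse (sqrt ((infdist (z t) F)\<^sup>2)) / 2 * (2 * ((z t - \<xi>) \<bullet> z')) = (z' \<bullet> (z t - \<xi>)) / norm (z t - \<xi>)"
    unfolding \<xi>(2) dist_norm inner_commute[of z'] by (simp add: field_simps)
  ultimately show ?thesis
    by (simp add: has_real_derivative_iff_has_vector_derivative infdist_nonneg)
qed

text \<open>While the distance is positive, distance plus \<open>\<epsilon> * t\<close> cannot
  increase, so an initial distance of at most \<open>\<epsilon> * \<tau>\<close> is used up by time
  \<open>\<tau>\<close>; after a zero the same estimate keeps the distance from becoming positive
  again. The inequality over \<open>\<zeta>\<close> inside \<open>speed\<close> characterizes
  \<open>\<xi>\<close> as the nearest point of \<open>F\<close>.\<close>

lemma finite_time_arrival:
  fixes F :: "'a::euclidean_space set"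
  assumes F: "convex F" "closed F" "F \<noteq> {}" and "\<tau> \<ge> 0"
    and ac: "abs_cont_on_interval 0 \<tau> z" and N: "negligible N"
    and speed: "\<And>t. t \<in> {0..\<tau>} - N \<Longrightarrow> \<exists>z'. (z has_vector_derivative z') (at t) \<and>
          (\<forall>\<xi>\<in>F. (\<forall>\<zeta>\<in>F. (z t - \<xi>) \<bullet> (\<zeta> - \<xi>) \<le> 0) \<longrightarrow> z' \<bullet> (z t - \<xi>) \<le> - \<epsilon> * norm (z t - \<xi>))"
    and start: "infdist (z 0) F \<le> \<epsilon> * \<tau>" and "\<epsilon> \<ge> 0"
  shows "z \<tau> \<in> F"
proof (rule ccontr)
  assume "z \<tau> \<notin> F"
  define g where "g t = infdist (z t) F" for t
  have g0: "g t \<ge> 0" for t by (simp add: g_def infdist_nonneg)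
  have "g \<tau> > 0"
    using \<open>z \<tau> \<notin> F\<close> in_closed_iff_infdist_zero[OF F(2,3)] g0[of \<tau>] by (simp add: g_def order_less_le)
  have acg: "abs_cont_on_interval 0 \<tau> g"
    unfolding g_def
  proof (rule abs_cont_lipschitz_compose[OF ac])
    show "norm (infdist x F - infdist y F) \<le> 1 * norm (x - y)" for x y
      using infdist_triangle_abs[of x F y] by (simp add: dist_norm)
  qed
  have descent: "g \<tau> + \<epsilon> * \<tau> \<le> g s + \<epsilon> * s" if s: "0 \<le> s" "s \<le> \<tau>" and pos: "\<And>t. s < t \<Longrightarrow> t \<le> \<tau> \<Longrightarrow> g t > 0" for s
  \<comment> \<open>The left endpoint joins the null set because the distance may vanish there and
    need not be differentiable.\<close>
  proof (rule abs_cont_nonincreasing[of s \<tau> "\<lambda>t. g t + \<epsilon> * t" "insert s N"])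
    have "\<epsilon>-lipschitz_on {s..\<tau>} (\<lambda>t. \<epsilon> * t)"
      using \<open>\<epsilon> \<ge> 0\<close> by (intro lipschitz_onI) (auto simp: dist_real_def right_diff_distrib[symmetric] abs_mult)
    then show "abs_cont_on_interval s \<tau> (\<lambda>t. g t + \<epsilon> * t)"
      using abs_cont_on_interval_subset[OF acg s(1) order_refl]
      by (intro abs_cont_add) (auto intro: abs_cont_lipschitz)
    show "negligible (insert s N)" using N by simp
    fix t assume t: "t \<in> {s..\<tau>} - insert s N"
    then have "t \<in> {0..\<tau>} - N" using s by auto
    from speed[OF this] obtain z' where z': "(z has_vector_derivative z') (at t)"
      and sp: "\<And>\<xi>. \<xi> \<in> F \<Longrightarrow> (\<And>\<zeta>. \<zeta> \<in> F \<Longrightarrow> (z t - \<xi>) \<bullet> (\<zeta> - \<xi>) \<le> 0) \<Longrightarrow> z' \<bullet> (z t - \<xi>) \<le> - \<epsilon> * norm (z t - \<xi>)"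
      by blast
    obtain \<xi> where \<xi>: "\<xi> \<in> F" "infdist (z t) F = dist (z t) \<xi>"
      using infdist_attains_inf[OF F(2,3)] by metis
    have "infdist (z t) F > 0" using pos[of t] t by (auto simp: g_def)
    then have np: "norm (z t - \<xi>) > 0" by (simp add: \<xi>(2) dist_norm)
    have "(z t - \<xi>) \<bullet> (\<zeta> - \<xi>) \<le> 0" if "\<zeta> \<in> F" for \<zeta>
      using any_closest_point_dot[OF F(1,2) \<xi>(1) that] infdist_le \<xi>(2) by metis
    then have le: "z' \<bullet> (z t - \<xi>) \<le> - \<epsilon> * norm (z t - \<xi>)" by (rule sp[OF \<xi>(1)])
    have "((\<lambda>t. g t + \<epsilon> * t) has_vector_derivative (z' \<bullet> (z t - \<xi>)) / norm (z t - \<xi>) + \<epsilon>) (at t)"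
      unfolding g_def
      by (intro has_vector_derivative_add has_vector_derivative_infdist[OF F(1,2) \<xi> z'] \<open>infdist (z t) F > 0\<close>)
        (auto intro!: derivative_eq_intros simp: has_real_derivative_iff_has_vector_derivative[symmetric])
    moreover have "(z' \<bullet> (z t - \<xi>)) / norm (z t - \<xi>) + \<epsilon> \<le> 0"
      using le np by (simp add: field_simps)
    ultimately show "\<exists>D. ((\<lambda>t. g t + \<epsilon> * t) has_vector_derivative D) (at t) \<and> D \<le> 0" by blast
  qed (use s in auto)
  \<comment> \<open>If the distance has zeros, \<open>descent\<close> starts at the last one,
    \<open>Sup Z\<close>; otherwise it starts at time 0.\<close>
  define Z where "Z = {t \<in> {0..\<tau>}. g t = 0}"
  show False
  proof (cases "Z = {}")
    case True
    have "g t > 0" if "0 < t" "t \<le> \<tau>" for t using True that g0[of t] by (auto simp: Z_def order_less_le)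
    then have "g \<tau> + \<epsilon> * \<tau> \<le> g 0 + \<epsilon> * 0" using \<open>\<tau> \<ge> 0\<close> by (intro descent) auto
    then show False using start \<open>g \<tau> > 0\<close> by (simp add: g_def)
  next
    case False
    have "closed Z"
      unfolding Z_def using abs_cont_imp_continuous_on[OF acg]
      by (intro continuous_closed_preimage_constant) auto
    moreover have "bdd_above Z" by (rule bdd_above_mono[of "{0..\<tau>}"]) (auto simp: Z_def)
    ultimately have sZ: "Sup Z \<in> Z" using False by (intro closed_contains_Sup)
    have "g t > 0" if "Sup Z < t" "t \<le> \<tau>" for t
    proof -
      have "t \<notin> Z" using that(1) cSup_upper[OF _ \<open>bdd_above Z\<close>] by fastforce
      moreover have "t \<ge> 0" using that(1) sZ by (auto simp: Z_def)
      ultimately show ?thesis using that(2) g0[of t] by (auto simp: Z_def order_less_le)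
    qed
    then have "g \<tau> + \<epsilon> * \<tau> \<le> g (Sup Z) + \<epsilon> * Sup Z" using sZ by (intro descent) (auto simp: Z_def)
    moreover have "\<epsilon> * Sup Z \<le> \<epsilon> * \<tau>" using sZ \<open>\<epsilon> \<ge> 0\<close> by (intro mult_left_mono) (auto simp: Z_def)
    ultimately show False using \<open>g \<tau> > 0\<close> sZ by (simp add: Z_def)
  qed
qed

section \<open>Eigenvalues and the operator norm\<close>

lemma inner_matrix_vector_mult:
  fixes A :: "real^'n^'m"
  shows "(A *v x) \<bullet> y = x \<bullet> (transpose A *v y)"
  by (metis dot_lmul_matrix inner_commute transpose_matrix_vector)

text \<open>Eigenvectors of distinct eigenvalues are orthogonal, hence independent, and there is
  room for finitely many only. This makes \<open>Max (eigenvalues T)\<close> meaningful.\<close>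

lemma finite_eigenvalues_symmetric:
  fixes T :: "real^'n^'n"
  assumes "transpose T = T"
  shows "finite (eigenvalues T)"
proof -
  obtain v where v: "\<And>\<mu>. \<mu> \<in> eigenvalues T \<Longrightarrow> v \<mu> \<noteq> 0 \<and> T *v v \<mu> = \<mu> *\<^sub>R v \<mu>"
  proof -
    have "\<forall>\<mu>. \<exists>v. \<mu> \<in> eigenvalues T \<longrightarrow> v \<noteq> 0 \<and> T *v v = \<mu> *\<^sub>R v" unfolding eigenvalues_def by blast
    then show ?thesis using that by metis
  qed
  have orth: "v \<mu> \<bullet> v \<nu> = 0" if "\<mu> \<in> eigenvalues T" "\<nu> \<in> eigenvalues T" "\<mu> \<noteq> \<nu>" for \<mu> \<nu>
  proof -
    have "\<mu> * (v \<mu> \<bullet> v \<nu>) = (T *v v \<mu>) \<bullet> v \<nu>" using v[OF that(1)] by simp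
    also have "\<dots> = v \<mu> \<bullet> (T *v v \<nu>)"
      by (simp add: inner_matrix_vector_mult assms)
    also have "\<dots> = \<nu> * (v \<mu> \<bullet> v \<nu>)" using v[OF that(2)] by simp
    finally show ?thesis using that(3) by simp
  qed
  have "inj_on v (eigenvalues T)"
  proof (rule inj_onI, rule ccontr)
    fix \<mu> \<nu> assume "\<mu> \<in> eigenvalues T" "\<nu> \<in> eigenvalues T" "v \<mu> = v \<nu>" "\<mu> \<noteq> \<nu>"
    then show False using orth v by (metis inner_eq_zero_iff)
  qed
  moreover have "independent (v ` eigenvalues T)"
    using orth v by (intro pairwise_orthogonal_independent) (auto simp: pairwise_def orthogonal_def)
  ultimately show ?thesis using finite_imageD independent_imp_finite by blast
qed

text \<open>A maximizer of the Rayleigh quotient is an eigenvector.\<close>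

lemma norm_le_sqrt_Max_eigenvalues:
  fixes S :: "real^'n^'n"
  shows "norm (S *v x) \<le> sqrt (Max (eigenvalues (transpose S ** S))) * norm x"
proof -
  define T where "T = transpose S ** S"
  have T: "(T *v x) \<bullet> y = (S *v x) \<bullet> (S *v y)" for x y
    unfolding T_def by (metis inner_commute inner_matrix_vector_mult matrix_vector_mul_assoc)
  have "compact (sphere (0 :: real^'n) 1)" "sphere (0 :: real^'n) 1 \<noteq> {}" by auto
  moreover have "continuous_on (sphere 0 1) (\<lambda>x. (S *v x) \<bullet> (S *v x))"
    by (intro continuous_intros)
  ultimately obtain v where v: "norm v = 1"
    and vmax: "\<And>x. norm x = 1 \<Longrightarrow> (S *v x) \<bullet> (S *v x) \<le> (S *v v) \<bullet> (S *v v)"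
    using continuous_attains_sup by (metis (no_types, lifting) dist_0_norm mem_sphere)
  define \<mu> where "\<mu> = (S *v v) \<bullet> (S *v v)"
  have le: "(S *v x) \<bullet> (S *v x) \<le> \<mu> * (x \<bullet> x)" for x
  proof (cases "x = 0")
    case False
    have "(S *v ((1 / norm x) *\<^sub>R x)) \<bullet> (S *v ((1 / norm x) *\<^sub>R x)) \<le> \<mu>"
      unfolding \<mu>_def using False by (intro vmax) simp
    then show ?thesis using False
      by (simp add: matrix_vector_mult_scaleR power2_norm_eq_inner[symmetric] field_simps power2_eq_square)
  qed simp
  define r where "r = \<mu> *\<^sub>R v - T *v v"
  \<comment> \<open>By \<open>le\<close> this form is nonnegative, and it vanishes at the maximizer
    \<open>v\<close>, so its first variation at \<open>v\<close> must vanish. In the direction of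
    the residual \<open>r\<close> that variation is \<open>2 * (r \<bullet> r)\<close>.\<close>
  define q where "q x = \<mu> * (x \<bullet> x) - (S *v x) \<bullet> (S *v x)" for x
  have qv: "q v = 0" using v by (simp add: q_def \<mu>_def norm_eq_1)
  have q: "q (v + t *\<^sub>R r) = 2 * t * (r \<bullet> r) + t\<^sup>2 * q r" for t
  proof -
    have "q (v + t *\<^sub>R r) = q v + 2 * t * (\<mu> * (v \<bullet> r) - (S *v v) \<bullet> (S *v r)) + t\<^sup>2 * q r"
      unfolding q_def
      by (simp add: matrix_vector_right_distrib matrix_vector_mult_scaleR inner_add_left inner_add_right
          inner_commute algebra_simps power2_eq_square)
    moreover have "\<mu> * (v \<bullet> r) - (S *v v) \<bullet> (S *v r) = r \<bullet> r"
      unfolding T[symmetric] by (subst (3) r_def) (simp add: inner_diff_left)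
    ultimately show ?thesis using qv by simp
  qed
  have "r = 0"
  proof (rule ccontr)
    assume "r \<noteq> 0"
    then have rr: "r \<bullet> r > 0" by simp
    have q0: "q r \<ge> 0" using le[of r] by (simp add: q_def)
    \<comment> \<open>Negative, but so small that \<open>t * q r\<close> cannot outweigh
      \<open>2 * (r \<bullet> r)\<close>; the added 1 covers the case
      \<open>q r = 0\<close>.\<close>
    define t where "t = - (r \<bullet> r) / (q r + 1)"
    have "0 \<le> q (v + t *\<^sub>R r)" using le by (simp add: q_def)
    also have "\<dots> = t * (2 * (r \<bullet> r) + t * q r)" unfolding q by (simp add: algebra_simps power2_eq_square)
    also have "\<dots> < 0"
    proof (rule mult_neg_pos)
      show "t < 0" using rr q0 by (simp add: t_def)
      have "- t * q r \<le> r \<bullet> r" using rr q0 by (simp add: t_def field_simps)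
      then show "0 < 2 * (r \<bullet> r) + t * q r" using rr by (simp only: mult_minus_left)
    qed
    finally show False by simp
  qed
  then have "\<mu> \<in> eigenvalues T" unfolding eigenvalues_def r_def using v by (auto intro!: exI[of _ v])
  moreover have "transpose T = T" by (simp add: T_def matrix_transpose_mul)
  ultimately have "\<mu> \<le> Max (eigenvalues T)" using finite_eigenvalues_symmetric by (intro Max_ge)
  then have "(norm (S *v x))\<^sup>2 \<le> Max (eigenvalues T) * (norm x)\<^sup>2"
    using le[of x] mult_right_mono[of \<mu> "Max (eigenvalues T)" "(norm x)\<^sup>2"] by (simp add: power2_norm_eq_inner)
  then have "norm (S *v x) \<le> sqrt (Max (eigenvalues T) * (norm x)\<^sup>2)" by (rule real_le_rsqrt)
  then show ?thesis by (simp add: real_sqrt_mult T_def)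
qed

section \<open>Matrices and boxes\<close>

lemma matrix_inv_mult:
  fixes A :: "real^'n^'n"
  assumes "invertible A"
  shows "A ** matrix_inv A = mat 1" "matrix_inv A ** A = mat 1"
proof -
  have "\<exists>B. A ** B = mat 1 \<and> B ** A = mat 1" using assms by (simp add: invertible_def)
  then have "A ** matrix_inv A = mat 1 \<and> matrix_inv A ** A = mat 1"
    unfolding matrix_inv_def by (rule someI_ex)
  then show "A ** matrix_inv A = mat 1" "matrix_inv A ** A = mat 1" by auto
qed

lemma invertible_if_injective:
  fixes A :: "real^'n^'n"
  assumes "\<And>x. A *v x = 0 \<Longrightarrow> x = 0"
  shows "invertible A"
  using assms by (auto simp: invertible_left_inverse matrix_left_invertible_ker)

lemma diag_matrix_mult_component [simp]: "(diag_matrix v *v x) $ j = v $ j * x $ j"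
  by (simp add: diag_matrix_def matrix_vector_mult_def if_distrib[of "\<lambda>c. c * _"] cong: if_cong)

lemma matrix_vector_mult_sum_columns:
  fixes A :: "real^'n^'m"
  shows "A *v x = (\<Sum>i\<in>UNIV. x $ i *\<^sub>R column i A)"
  by (simp add: matrix_mult_sum scalar_mult_eq_scaleR)

lemma axis_one_inner [simp]: "axis j (1::real) \<bullet> x = x $ j"
  by (simp add: inner_axis')

text \<open>The box is an affine image of the unit cube, whose vertices are known. Coordinates with
  \<open>a $ i = b $ i\<close> matter, because the face studied below is flat in the directions of
  \<open>I\<^sub>0\<close>.\<close>

lemma cbox_subset_convex_hull_vertices:
  fixes a b :: "real^'n"
  shows "cbox a b \<subseteq> convex hull {x. \<forall>i. x $ i = a $ i \<or> x $ i = b $ i}"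
proof
  fix x assume x: "x \<in> cbox a b"
  define f where "f z = (\<chi> i. (b $ i - a $ i) * z $ i)" for z :: "real^'n"
  have lin: "linear f" by (rule linearI) (auto simp: f_def vec_eq_iff algebra_simps)
  \<comment> \<open>In a flat coordinate \<open>f\<close> multiplies by 0, so any value from
    \<open>{0..1}\<close> represents \<open>x\<close>; 0 is chosen.\<close>
  define z where "z = (\<chi> i. if a $ i = b $ i then 0 else (x $ i - a $ i) / (b $ i - a $ i))"
  have x': "a $ i \<le> x $ i" "x $ i \<le> b $ i" for i using x by (auto simp: mem_box_cart)
  have "z $ i \<in> {0..1}" for i using x'[of i] by (auto simp: z_def divide_simps)
  then have "0 \<le> z \<bullet> i \<and> z \<bullet> i \<le> 1" if "i \<in> Basis" for i using that by (auto simp: Basis_vec_def inner_axis)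
  then have "z \<in> cbox 0 One" by (simp add: mem_box inner_sum_left inner_Basis sum.If_cases)
  moreover have "{x :: real^'n. \<forall>i\<in>Basis. x \<bullet> i = 0 \<or> x \<bullet> i = 1} = {x. \<forall>i. x $ i = 0 \<or> x $ i = 1}"
    by (auto simp: Basis_vec_def inner_axis)
  ultimately have "z \<in> convex hull {x. \<forall>i. x $ i = 0 \<or> x $ i = 1}" by (simp add: unit_interval_convex_hull)
  then have "a + f z \<in> (+) a ` (convex hull (f ` {x. \<forall>i. x $ i = 0 \<or> x $ i = 1}))"
    using convex_hull_linear_image[OF lin] by blast
  moreover have "a + f z = x"
    unfolding vec_eq_iff
  proof
    show "(a + f z) $ i = x $ i" for i using x'[of i] by (auto simp: f_def z_def)
  qed
  moreover have "(+) a ` (f ` {x. \<forall>i. x $ i = 0 \<or> x $ i = 1}) \<subseteq> {x. \<forall>i. x $ i = a $ i \<or> x $ i = b $ i}"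
  proof
    fix w assume "w \<in> (+) a ` (f ` {x. \<forall>i. x $ i = 0 \<or> x $ i = 1})"
    then obtain z where z: "\<And>i. z $ i = 0 \<or> z $ i = 1" "w = a + f z" by blast
    have "w $ i = a $ i \<or> w $ i = b $ i" for i using z(1)[of i] by (auto simp: z(2) f_def)
    then show "w \<in> {x. \<forall>i. x $ i = a $ i \<or> x $ i = b $ i}" by simp
  qed
  ultimately show "x \<in> convex hull {x. \<forall>i. x $ i = a $ i \<or> x $ i = b $ i}"
    using hull_mono convex_hull_translation by (metis (no_types, lifting) subsetD)
qed

section \<open>Geometry of the network\<close>

locale elastoplastic_network =
  fixes E :: "('m::finite, 'n::finite, 'p::finite) elastoplastic"
  assumes system: "elastoplastic_system E"
begin

section \<open>The energy scalar product given by \<open>A_mat E\<close>\<close>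

lemma stiffness_pos: "a_diag E $ j > 0"
  using system by (simp add: elastoplastic_system_def)

lemma A_component [simp]: "(A_mat E *v x) $ j = a_diag E $ j * x $ j"
  by (simp add: A_mat_def)

text \<open>The square root of \<open>A_mat E\<close>. It carries the energy scalar product to the
  Euclidean one, which makes Euclidean results on projections and operator norms applicable.\<close>

definition sqrt_A :: "real^'m^'m" where
  "sqrt_A = diag_matrix (\<chi> j. sqrt (a_diag E $ j))"

lemma inner_sqrt_A: "(sqrt_A *v x) \<bullet> (sqrt_A *v y) = x \<bullet> (A_mat E *v y)"
proof -
  have "\<bar>a_diag E $ j\<bar> = a_diag E $ j" for j
    using stiffness_pos[of j] by simp
  then show ?thesis
    by (simp add: inner_vec_def sqrt_A_def mult_ac)
qed

lemma norm_sqrt_A: "norm (sqrt_A *v x) = norm_A E x"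
  by (simp add: norm_eq_sqrt_inner inner_sqrt_A norm_A_def)

lemma sqrt_A_eq_0_iff: "sqrt_A *v x = 0 \<longleftrightarrow> x = 0"
  using stiffness_pos by (simp add: vec_eq_iff sqrt_A_def less_imp_neq[symmetric])

lemma norm_A_eq_0_iff: "norm_A E x = 0 \<longleftrightarrow> x = 0"
  using sqrt_A_eq_0_iff norm_sqrt_A by (metis norm_eq_zero)

lemma norm_A_scaleR: "norm_A E (c *\<^sub>R x) = \<bar>c\<bar> * norm_A E x"
  by (simp flip: norm_sqrt_A add: matrix_vector_mult_scaleR)

lemma norm_A_nonneg: "norm_A E x \<ge> 0"
  by (simp flip: norm_sqrt_A)

lemma inner_A_eq_0_imp: "x \<bullet> (A_mat E *v x) = 0 \<Longrightarrow> x = 0"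
  using norm_A_eq_0_iff by (simp add: norm_A_def)

lemma dist_A_le: "z \<in> S \<Longrightarrow> dist_A E x S \<le> norm_A E (x - z)"
  unfolding dist_A_def using norm_A_nonneg by (intro cINF_lower bdd_belowI[of _ 0]) auto

section \<open>The kernel of \<open>P_mat E\<close> and its orthogonality to
  \<open>V_space E\<close>\<close>

abbreviation (input) DQ :: "(real^'m) set" where
  "DQ \<equiv> (\<lambda>k. D_mat E *v Q_col E k) ` {..<CARD('n) - 2}"

text \<open>The kernel of the transpose of \<^term>\<open>Dperp E\<close> is the range of \<^term>\<open>D_mat E\<close> by counting
  dimensions, and the condition on \<^term>\<open>R_vec E\<close> cuts out a hyperplane of it.\<close>

lemma kernel_P_in_span:
  assumes "P_mat E *v z = 0"
  shows "z \<in> span DQ"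
proof -
  let ?n = "CARD('n)" and ?m = "CARD('m)"
  have n: "2 \<le> ?n" "?n \<le> ?m" "CARD('p) = ?m - ?n + 1"
    and rD: "rank (D_mat E) = ?n - 1" and rP: "rank (Dperp E) = CARD('p)"
    and rDR: "rank (transpose (D_mat E) ** (columnvector (R_vec E) :: real^1^'m)) = 1"
    and dDQ: "dim DQ = ?n - 2" and RDQ: "\<And>k. k < ?n - 2 \<Longrightarrow> R_vec E \<bullet> (D_mat E *v Q_col E k) = 0"
    and DD: "transpose (Dperp E) ** D_mat E = 0"
    using system by (auto simp: elastoplastic_system_def)
  have Pz: "R_vec E \<bullet> z = 0" "\<And>k. column k (Dperp E) \<bullet> z = 0"
  proof -
    have "(P_mat E *v z) $ None = R_vec E \<bullet> z" "\<And>k. (P_mat E *v z) $ Some k = column k (Dperp E) \<bullet> z"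
      by (auto simp: P_mat_def matrix_vector_mul_component)
    then show "R_vec E \<bullet> z = 0" "\<And>k. column k (Dperp E) \<bullet> z = 0" using assms by auto
  qed
  \<comment> \<open>An orthogonal complement, hence the kernel of the transpose of
    \<open>Dperp E\<close>. Its dimension is \<open>CARD('m) - CARD('p) = CARD('n) - 1\<close>, the
    rank of \<open>D_mat E\<close>.\<close>
  define K where "K = {y \<in> UNIV. \<forall>x\<in>range ((*v) (Dperp E)). orthogonal x y}"
  define X where "X = range ((*v) (D_mat E))"
  have subX: "subspace X"
    unfolding X_def by (intro linear_subspace_image matrix_vector_mul_linear subspace_UNIV)
  have subK: "subspace K"
    unfolding K_def by (rule subspaceI) (auto simp: orthogonal_def inner_add_right)
  have "X \<subseteq> K"
  proof -
    have "(Dperp E *v x) \<bullet> (D_mat E *v y) = 0" for x y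
    proof -
      have "(Dperp E *v x) \<bullet> (D_mat E *v y) = x \<bullet> ((transpose (Dperp E) ** D_mat E) *v y)"
        by (simp add: inner_matrix_vector_mult flip: matrix_vector_mul_assoc)
      then show ?thesis by (simp add: DD)
    qed
    then show ?thesis by (auto simp: X_def K_def orthogonal_def)
  qed
  moreover have "dim K + dim (range ((*v) (Dperp E))) = dim (UNIV :: (real^'m) set)"
    unfolding K_def by (intro dim_subspace_orthogonal_to_vectors linear_subspace_image
        matrix_vector_mul_linear subspace_UNIV) auto
  then have "dim K \<le> dim X"
    using n rD rP by (simp add: X_def rank_dim_range)
  ultimately have "X = K" by (intro subspace_dim_equal subX subK)
  have "z \<in> K"
  proof -
    have "(Dperp E *v x) \<bullet> z = 0" for x
      by (simp add: matrix_vector_mult_sum_columns[of "Dperp E"] inner_sum_left Pz(2))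
    then show ?thesis by (auto simp: K_def orthogonal_def)
  qed
  define Y where "Y = {y \<in> X. R_vec E \<bullet> y = 0}"
  have subY: "subspace Y" using subX unfolding Y_def subspace_def by (auto simp: inner_add_right)
  \<comment> \<open>Otherwise \<open>R_vec E\<close> would be orthogonal to the range of
    \<open>D_mat E\<close>, against the rank condition. So the dimension drops to
    \<open>CARD('n) - 2\<close>, which the vectors in \<open>DQ\<close> already fill.\<close>
  have "Y \<noteq> X"
  proof
    assume "Y = X"
    have "(D_mat E *v x) \<bullet> R_vec E = 0" for x
    proof -
      have "D_mat E *v x \<in> Y" unfolding \<open>Y = X\<close> by (simp add: X_def)
      then show ?thesis by (simp add: Y_def inner_commute)
    qed
    then have "(transpose (D_mat E) *v R_vec E) \<bullet> (transpose (D_mat E) *v R_vec E) = 0"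
      by (metis inner_matrix_vector_mult)
    then have "transpose (D_mat E) *v R_vec E = 0" by simp
    then have "transpose (D_mat E) ** (columnvector (R_vec E) :: real^1^'m) = 0"
      by (simp add: vec_eq_iff matrix_matrix_mult_def matrix_vector_mult_def columnvector_def)
    then show False using rDR by simp
  qed
  then have "Y \<subset> X" by (auto simp: Y_def)
  then have "dim Y < dim X" using subX subY by (metis dim_psubset span_eq_iff)
  then have "dim Y \<le> dim (span DQ)" using rD dDQ by (simp add: X_def rank_dim_range)
  moreover have "span DQ \<subseteq> Y"
    using RDQ by (intro span_minimal subY) (auto simp: Y_def X_def)
  ultimately have "span DQ = Y" by (intro subspace_dim_equal subY subspace_span) auto
  moreover have "z \<in> Y" using \<open>z \<in> K\<close> \<open>X = K\<close> Pz(1) by (simp add: Y_def)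
  ultimately show ?thesis by simp
qed

text \<open>The columns of \<open>V_basis E\<close> are orthogonal in energy to \<open>DQ\<close>,
  whose span contains the kernel. For \<open>z = y\<close> this gives injectivity of
  \<open>P_mat E\<close> on \<open>V_space E\<close>; for general \<open>z\<close> it shows that
  products with \<open>V_space E\<close> depend on \<open>P_mat E *v z\<close> only.\<close>

lemma kernel_P_orthogonal:
  assumes "P_mat E *v z = 0" "y \<in> V_space E"
  shows "z \<bullet> (A_mat E *v y) = 0"
proof -
  obtain c where y: "y = V_basis E *v c" using assms(2) by (auto simp: V_space_def)
  have "u \<bullet> (A_mat E *v y) = 0" if "u \<in> DQ" for u
  proof -
    have "u \<bullet> (A_mat E *v column i (V_basis E)) = 0" for i
      using system that by (auto simp: elastoplastic_system_def)
    moreover have "A_mat E *v y = (\<Sum>i\<in>UNIV. c $ i *\<^sub>R (A_mat E *v column i (V_basis E)))"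
      unfolding y matrix_vector_mult_sum_columns[of "V_basis E"]
      by (simp add: linear_sum[OF matrix_vector_mul_linear] matrix_vector_mult_scaleR)
    ultimately show ?thesis by (simp add: inner_sum_right)
  qed
  then have "span DQ \<subseteq> {u. (A_mat E *v y) \<bullet> u = 0}"
    by (intro span_minimal subspace_hyperplane) (auto simp: inner_commute)
  then show ?thesis using kernel_P_in_span[OF assms(1)] by (auto simp: inner_commute)
qed

section \<open>Inverting \<open>P_mat E\<close> on \<open>V_space E\<close>\<close>

lemma subspace_V: "subspace (V_space E)"
  unfolding V_space_def by (intro linear_subspace_image matrix_vector_mul_linear subspace_UNIV)

lemma P_injective_on_V:
  assumes "P_mat E *v y = 0" "y \<in> V_space E"
  shows "y = 0"
  using kernel_P_orthogonal[OF assms] by (rule inner_A_eq_0_imp)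

lemma inj_V_basis: "inj ((*v) (V_basis E))"
proof -
  \<comment> \<open>\<open>columns\<close> is a set and does not see repetitions; with injective
    indexing its cardinality is the number of columns, so independence means full rank.\<close>
  have inj: "inj (\<lambda>k. column k (V_basis E))" and "independent (columns (V_basis E))"
    using system by (auto simp: elastoplastic_system_def)
  then have "dim (columns (V_basis E)) = card (columns (V_basis E))"
    by (intro dim_eq_card_independent)
  also have "columns (V_basis E) = range (\<lambda>k. column k (V_basis E))"
    by (auto simp: columns_def)
  also have "card \<dots> = CARD('p option)" using inj by (rule card_image)
  finally have "dim (columns (V_basis E)) = CARD('p option)"
    by (simp add: columns_def full_SetCompr_eq)
  then show ?thesis
    unfolding full_rank_injective[symmetric] column_rank_def by (simp add: dim_vec_eq)
qed

lemma invertible_W: "invertible (W_mat E)"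
proof (rule invertible_if_injective)
  fix x assume "W_mat E *v x = 0"
  then have "V_basis E *v x = 0"
    by (intro P_injective_on_V) (auto simp: W_mat_def V_space_def matrix_vector_mul_assoc)
  then show "x = 0" using injD[OF inj_V_basis, of x 0] by simp
qed

text \<open>The inverse of \<open>P_mat E\<close> restricted to \<open>V_space E\<close>; every
  \<open>n_vec E j\<close> and every \<open>c_shift E t\<close> is an image under it.\<close>

definition lift :: "real^('p option) \<Rightarrow> real^'m" where
  "lift b = (V_basis E ** matrix_inv (W_mat E)) *v b"

lemma linear_lift: "linear lift"
  unfolding lift_def[abs_def] by (rule matrix_vector_mul_linear)

lemma lift_in_V: "lift b \<in> V_space E"
  by (auto simp: lift_def V_space_def simp flip: matrix_vector_mul_assoc)

lemma P_lift: "P_mat E *v lift b = b"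
  unfolding lift_def using matrix_inv_mult(1)[OF invertible_W]
  by (metis W_mat_def matrix_mul_assoc matrix_vector_mul_assoc matrix_vector_mul_lid)

lemma lift_P:
  assumes "y \<in> V_space E"
  shows "lift (P_mat E *v y) = y"
proof -
  have "lift (P_mat E *v y) - y = 0"
    using assms by (intro P_injective_on_V subspace_diff subspace_V lift_in_V)
      (auto simp: matrix_vector_mult_diff_distrib P_lift)
  then show ?thesis by simp
qed

text \<open>The difference \<open>lift (P_mat E *v z) - z\<close> lies in the kernel of
  \<open>P_mat E\<close>. Thus \<open>lift\<close> after \<open>P_mat E\<close> is the projection
  onto \<open>V_space E\<close> that is orthogonal in energy.\<close>

lemma inner_lift_P:
  assumes "y \<in> V_space E"
  shows "lift (P_mat E *v z) \<bullet> (A_mat E *v y) = z \<bullet> (A_mat E *v y)"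
  using kernel_P_orthogonal[of "lift (P_mat E *v z) - z" y] assms
  by (simp add: matrix_vector_mult_diff_distrib P_lift inner_diff_left)

lemma n_vec_eq_lift: "n_vec E j = lift (P_mat E *v axis j 1)"
  by (simp add: n_vec_def lift_def matrix_vector_mul_assoc)

lemma inner_n_vec:
  assumes "y \<in> V_space E"
  shows "n_vec E j \<bullet> (A_mat E *v y) = a_diag E $ j * y $ j"
  unfolding n_vec_eq_lift using inner_lift_P[OF assms, of "axis j 1"] by simp

lemma c_shift_eq: "c_shift E t = - (load E t *\<^sub>R lift (axis None 1))"
  by (simp add: c_shift_def lift_def)

text \<open>\<open>A_mat E\<close> is diagonal, so bounding each stress difference by the width of
  its elastic range bounds the norm. This controls the initial distance to the face.\<close>

lemma norm_A_diff_C_le: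
  assumes "x \<in> C_set E" "y \<in> C_set E"
  shows "norm_A E (x - y) \<le> norm_A E (matrix_inv (A_mat E) *v c_plus E - matrix_inv (A_mat E) *v c_minus E)"
proof -
  define v where "v = matrix_inv (A_mat E) *v c_plus E - matrix_inv (A_mat E) *v c_minus E"
  have "invertible (A_mat E)"
  proof (rule invertible_if_injective)
    fix x assume "A_mat E *v x = 0"
    then have "x \<bullet> (A_mat E *v x) = 0" by simp
    then show "x = 0" by (rule inner_A_eq_0_imp)
  qed
  then have "A_mat E *v v = c_plus E - c_minus E"
    by (simp add: v_def matrix_vector_mult_diff_distrib matrix_vector_mul_assoc matrix_inv_mult)
  then have v: "a_diag E $ j * v $ j = c_plus E $ j - c_minus E $ j" for j
    by (metis A_component vector_minus_component)
  have "\<bar>x $ j - y $ j\<bar> \<le> \<bar>v $ j\<bar>" for j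
  proof -
    have "c_minus E $ j \<le> a_diag E $ j * x $ j \<and> a_diag E $ j * x $ j \<le> c_plus E $ j"
      "c_minus E $ j \<le> a_diag E $ j * y $ j \<and> a_diag E $ j * y $ j \<le> c_plus E $ j"
      using assms by (auto simp: C_set_def)
    then have "\<bar>a_diag E $ j * (x $ j - y $ j)\<bar> \<le> a_diag E $ j * v $ j"
      unfolding v by (auto simp: abs_le_iff right_diff_distrib)
    then have "a_diag E $ j * \<bar>x $ j - y $ j\<bar> \<le> a_diag E $ j * v $ j"
      using stiffness_pos[of j] by (simp add: abs_mult)
    then show ?thesis using stiffness_pos[of j] by simp
  qed
  then have "norm (sqrt_A *v (x - y)) \<le> norm (sqrt_A *v v)"
    using stiffness_pos by (intro norm_le_componentwise_cart)
      (simp add: sqrt_A_def abs_mult mult_left_mono less_imp_le)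
  then show ?thesis by (simp add: norm_sqrt_A v_def)
qed

lemma c_shift_has_vector_derivative:
  assumes "load E differentiable (at t)"
  shows "(c_shift E has_vector_derivative - lift (deriv (load E) t *\<^sub>R axis None 1)) (at t)"
proof -
  have "(load E has_vector_derivative deriv (load E) t) (at t)"
    using assms by (simp add: DERIV_deriv_iff_real_differentiable flip: has_real_derivative_iff_has_vector_derivative)
  then have "((\<lambda>t. - (load E t *\<^sub>R lift (axis None 1))) has_vector_derivative - (deriv (load E) t *\<^sub>R lift (axis None 1))) (at t)"
    by (intro derivative_intros)
      (auto intro!: bounded_linear.has_vector_derivative[OF bounded_linear_scaleR_left])
  then show ?thesis
    by (simp add: linear_scale[OF linear_lift] c_shift_eq[abs_def])
qed

lemma abs_cont_c_shift: "abs_cont_on_interval 0 T (c_shift E)"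
proof -
  obtain K where "K-lipschitz_on {0..} (load E)"
    using system by (auto simp: elastoplastic_system_def)
  then have "K-lipschitz_on {0..T} (load E)" by (rule lipschitz_on_subset) auto
  then have "abs_cont_on_interval 0 T (load E)" by (rule abs_cont_lipschitz)
  then have "abs_cont_on_interval 0 T (\<lambda>t. - (load E t *\<^sub>R lift (axis None 1)))"
  proof (rule abs_cont_lipschitz_compose)
    fix x y :: real
    have "- (x *\<^sub>R lift (axis None 1)) - - (y *\<^sub>R lift (axis None 1)) = (y - x) *\<^sub>R lift (axis None 1)"
      by (simp add: scaleR_diff_left)
    then show "norm (- (x *\<^sub>R lift (axis None 1)) - - (y *\<^sub>R lift (axis None 1))) \<le> norm (lift (axis None 1)) * norm (x - y)"
      by (simp add: abs_minus_commute mult.commute)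
  qed
  then show ?thesis by (simp add: c_shift_eq[abs_def])
qed

end

section \<open>The face and its normal cone\<close>

text \<open>The choices \<open>S = {}\<close> and \<open>S = J\<close> already cover the right-hand
  side. Intersecting over all families therefore imposes both elastic limits on the springs of
  \<open>J\<close>.\<close>

lemma Union_sign_changes: "\<Union> (sign_changes J) = J \<union> (\<lambda>(\<alpha>, j). (- \<alpha>, j)) ` J"
proof
  have "J \<in> sign_changes J" "(\<lambda>(\<alpha>, j). (- \<alpha>, j)) ` J \<in> sign_changes J"
    unfolding sign_changes_def by (auto intro: exI[of _ "{}"] exI[of _ J])
  then show "J \<union> (\<lambda>(\<alpha>, j). (- \<alpha>, j)) ` J \<subseteq> \<Union> (sign_changes J)" by blast
qed (auto simp: sign_changes_def)

text \<open>One family \<open>J\<close> is fixed: its sign changes involve the same springs, hence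
  the same normals and the same box. Indexing \<open>I\<^sub>0 \<union> J\<close> by the row indices
  of \<open>P_mat E\<close> makes the matrix with the columns \<open>P e_j\<close> square.\<close>

locale elastoplastic_face = elastoplastic_network E
  for E :: "('m::finite, 'n::finite, 'p::finite) elastoplastic" +
  fixes I\<^sub>0 J :: "(real \<times> 'm) set" and e :: "'p option \<Rightarrow> real \<times> 'm"
  assumes signs: "I\<^sub>0 \<union> J \<subseteq> {-1, 1} \<times> UNIV" and nonempty: "I\<^sub>0 \<noteq> {}"
    and disjoint: "I\<^sub>0 \<inter> J = {}" and enum: "bij_betw e UNIV (I\<^sub>0 \<union> J)"
    and spanning: "dim ((\<lambda>(\<alpha>, j). P_mat E *v (\<alpha> *\<^sub>R axis j 1)) ` (I\<^sub>0 \<union> J)) = CARD('p option)"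
begin

section \<open>Coordinates in the basis of normals and the dual stresses\<close>

abbreviation jx :: "'p option \<Rightarrow> 'm" where
  "jx k \<equiv> snd (e k)"

abbreviation al :: "'p option \<Rightarrow> real" where
  "al k \<equiv> fst (e k)"

lemma sign_cases: "al k = 1 \<or> al k = -1"
proof -
  have "e k \<in> {-1, 1} \<times> UNIV" using signs bij_betwE[OF enum] by blast
  then show ?thesis by (cases "e k") auto
qed

lemma enum_cases: "e k \<in> I\<^sub>0 \<or> e k \<in> J"
  using bij_betwE[OF enum] by blast

lemma enum_obtain:
  assumes "p \<in> I\<^sub>0 \<union> J"
  obtains k where "p = e k"
  using assms enum by (metis bij_betw_imp_surj_on imageE)

definition G_mat :: "real^('p option)^('p option)" where
  "G_mat = P_mat E ** (\<chi> r k. axis (jx k) 1 $ r)"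

lemma column_G: "column k G_mat = P_mat E *v axis (jx k) 1"
proof -
  have "column k G_mat = P_mat E *v column k (\<chi> r k. axis (jx k) 1 $ r)"
    unfolding G_mat_def by (metis matrix_vector_mul_assoc matrix_vector_mult_basis)
  moreover have "column k (\<chi> r k. axis (jx k) 1 $ r) = (axis (jx k) 1 :: real^'m)"
    by (simp add: column_def vec_eq_iff)
  ultimately show ?thesis by simp
qed

lemma invertible_G: "invertible G_mat"
proof (rule invertible_if_injective)
  \<comment> \<open>Signs do not change a span, so the rank condition on the signed vectors gives
    \<open>G_mat\<close> full rank.\<close>
  have "(\<lambda>(\<alpha>, j). P_mat E *v (\<alpha> *\<^sub>R axis j 1)) ` (I\<^sub>0 \<union> J) \<subseteq> span (columns G_mat)"
  proof clarify
    fix \<alpha> j assume "(\<alpha>, j) \<in> I\<^sub>0 \<union> J"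
    then obtain k where "(\<alpha>, j) = e k" by (rule enum_obtain)
    then have "P_mat E *v (\<alpha> *\<^sub>R axis j 1) = \<alpha> *\<^sub>R column k G_mat"
      unfolding column_G by (metis matrix_vector_mult_scaleR snd_conv)
    moreover have "column k G_mat \<in> columns G_mat" by (auto simp: columns_def)
    ultimately show "P_mat E *v (\<alpha> *\<^sub>R axis j 1) \<in> span (columns G_mat)"
      by (metis span_base span_scale)
  qed
  then have "CARD('p option) \<le> dim (columns G_mat)" using spanning dim_mono by metis
  then have "rank G_mat = CARD('p option)"
    using rank_bound[of G_mat] by (simp add: column_rank_def dim_vec_eq)
  then have "inj ((*v) G_mat)" by (simp only: full_rank_injective)
  then show "x = 0" if "G_mat *v x = 0" for x using injD[of "(*v) G_mat" x 0] that by simp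
qed

text \<open>For \<open>x\<close> in \<open>V_space E\<close> these are the coefficients in the basis
  \<open>n_vec E (jx k)\<close>; passing through \<open>P_mat E\<close> gives them the form in which
  they occur in \<open>L_mat\<close>.\<close>

definition coord :: "real^'m \<Rightarrow> real^('p option)" where
  "coord x = matrix_inv G_mat *v (P_mat E *v x)"

lemma coord_add: "coord (x + y) = coord x + coord y"
  by (simp add: coord_def matrix_vector_right_distrib)

lemma matrix_inv_G_column: "matrix_inv G_mat *v (P_mat E *v axis (jx k) 1) = axis k 1"
proof -
  have "matrix_inv G_mat *v (G_mat *v axis k 1) = axis k 1"
    using matrix_inv_mult(2)[OF invertible_G] by (simp add: matrix_vector_mul_assoc)
  then show ?thesis by (simp add: matrix_vector_mult_basis column_G)
qed

lemma coord_n_vec: "coord (n_vec E (jx k)) = axis k 1"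
  by (simp add: coord_def n_vec_eq_lift P_lift matrix_inv_G_column)

lemma coord_expansion:
  assumes "x \<in> V_space E"
  shows "x = (\<Sum>k\<in>UNIV. coord x $ k *\<^sub>R n_vec E (jx k))"
proof -
  have "G_mat *v (matrix_inv G_mat *v z) = z" for z
    by (simp add: matrix_vector_mul_assoc matrix_inv_mult(1)[OF invertible_G])
  then have "x = lift (G_mat *v coord x)"
    unfolding coord_def using lift_P[OF assms] by metis
  also have "G_mat *v coord x = (\<Sum>k\<in>UNIV. coord x $ k *\<^sub>R (P_mat E *v axis (jx k) 1))"
    by (simp add: matrix_vector_mult_sum_columns[of G_mat] column_G)
  also have "lift \<dots> = (\<Sum>k\<in>UNIV. coord x $ k *\<^sub>R n_vec E (jx k))"
    by (simp add: linear_sum[OF linear_lift] linear_scale[OF linear_lift] n_vec_eq_lift)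
  finally show ?thesis .
qed

text \<open>The coordinates with respect to the \<open>n\<^sub>j\<close> and the stresses in the springs \<open>j\<close> are dual to each other.\<close>

abbreviation strs :: "'p option \<Rightarrow> real^'m \<Rightarrow> real" where
  "strs k y \<equiv> a_diag E $ jx k * y $ jx k"

lemma inner_A_coord:
  assumes "x \<in> V_space E" "y \<in> V_space E"
  shows "x \<bullet> (A_mat E *v y) = (\<Sum>k\<in>UNIV. coord x $ k * strs k y)"
proof -
  have "x \<bullet> (A_mat E *v y) = (\<Sum>k\<in>UNIV. coord x $ k *\<^sub>R n_vec E (jx k)) \<bullet> (A_mat E *v y)"
    using coord_expansion[OF assms(1)] by simp
  then show ?thesis by (simp add: inner_sum_left inner_n_vec[OF assms(2)])
qed

lemma strs_unique:
  assumes "y \<in> V_space E" "y' \<in> V_space E" "\<And>k. strs k y = strs k y'"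
  shows "y = y'"
proof -
  have d: "y - y' \<in> V_space E" using assms subspace_V by (simp add: subspace_diff)
  have "strs k (y - y') = 0" for k using assms(3)[of k] by (simp add: right_diff_distrib)
  then have "(y - y') \<bullet> (A_mat E *v (y - y')) = 0"
    unfolding inner_A_coord[OF d d] by (simp only: mult_zero_right sum.neutral_const)
  then show ?thesis using inner_A_eq_0_imp by fastforce
qed

text \<open>The stress map, parametrized by \<open>lift\<close>, is injective between spaces of
  equal dimension, hence bijective. Its linear inverse transports boxes to faces and allows one
  stress to be changed alone.\<close>

lemma strs_prescribed:
  obtains point where "linear point" "\<And>b. point b \<in> V_space E" "\<And>b k. strs k (point b) = b $ k"
proof -
  define f where "f c = (\<chi> k. strs k (lift c))" for c
  have "linear f"
    by (rule linearI)
      (auto simp: f_def vec_eq_iff linear_add[OF linear_lift] linear_scale[OF linear_lift] algebra_simps)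
  moreover have "inj f"
  proof (rule injI)
    fix c c' assume "f c = f c'"
    then have "lift c = lift c'"
      by (intro strs_unique lift_in_V) (simp add: f_def vec_eq_iff)
    then show "c = c'" by (metis P_lift)
  qed
  ultimately obtain f' where f': "linear f'" "\<And>x. f (f' x) = x"
    using linear_injective_isomorphism by metis
  have "linear (\<lambda>b. lift (f' b))" using linear_compose[OF f'(1) linear_lift] by (simp add: o_def)
  moreover have "strs k (lift (f' b)) = b $ k" for b k
    using f'(2)[of b] by (simp add: f_def vec_eq_iff)
  ultimately show ?thesis using that lift_in_V by blast
qed

section \<open>The face as a box of stresses\<close>

definition lo :: "real^('p option)" where
  "lo = (\<chi> k. if e k \<in> I\<^sub>0 then c_lim E (al k) (jx k) else c_minus E $ jx k)"

definition hi :: "real^('p option)" where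
  "hi = (\<chi> k. if e k \<in> I\<^sub>0 then c_lim E (al k) (jx k) else c_plus E $ jx k)"

text \<open>The set F in stress coordinates. On \<open>I\<^sub>0\<close> the bounds
  \<open>lo\<close> and \<open>hi\<close> coincide, so equality and inequality constraints are
  treated alike.\<close>

definition face :: "(real^'m) set" where
  "face = {y \<in> V_space E. \<forall>k. lo $ k \<le> strs k y \<and> strs k y \<le> hi $ k}"

lemma lo_le_hi: "lo $ k \<le> hi $ k"
  using system by (simp add: lo_def hi_def elastoplastic_system_def)

lemma c_minus_le_lo: "c_minus E $ jx k \<le> lo $ k" and hi_le_c_plus: "hi $ k \<le> c_plus E $ jx k"
  using system by (auto simp: lo_def hi_def c_lim_def elastoplastic_system_def)

lemma F_set_eq_face:
  assumes "bij_betw I {1..M} (sign_changes J)"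
  shows "F_set E I\<^sub>0 I M = face"
proof -
  have "\<Union> (I ` {1..M}) = J \<union> (\<lambda>(\<alpha>, j). (- \<alpha>, j)) ` J"
    using assms Union_sign_changes[of J] by (simp add: bij_betw_imp_surj_on)
  then have F: "y \<in> F_set E I\<^sub>0 I M \<longleftrightarrow> (\<forall>p\<in>I\<^sub>0. y \<in> L_plane E p) \<and>
      (\<forall>p\<in>J \<union> (\<lambda>(\<alpha>, j). (- \<alpha>, j)) ` J. y \<in> L_half E p)" for y
    unfolding F_set_def by (simp flip: UN_iff) blast
  have I0: "(\<forall>p\<in>I\<^sub>0. y \<in> L_plane E p) \<longleftrightarrow>
      y \<in> V_space E \<and> (\<forall>k. e k \<in> I\<^sub>0 \<longrightarrow> strs k y = c_lim E (al k) (jx k))" for y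
  proof -
    have "(\<forall>p\<in>I\<^sub>0. y \<in> L_plane E p) \<longleftrightarrow> (\<forall>k. e k \<in> I\<^sub>0 \<longrightarrow> y \<in> L_plane E (e k))"
      by (metis UnCI enum_obtain)
    \<comment> \<open>An element of \<open>I\<^sub>0\<close> is what puts \<open>y\<close> into
      \<open>V_space E\<close>; an intersection over no planes would be the whole space.\<close>
    moreover have "\<exists>k. e k \<in> I\<^sub>0" using nonempty by (metis UnCI enum_obtain ex_in_conv)
    moreover have "y \<in> L_plane E (e k) \<longleftrightarrow> y \<in> V_space E \<and> strs k y = c_lim E (al k) (jx k)" for k
      by (simp add: L_plane_def case_prod_unfold)
    ultimately show ?thesis by blast
  qed
  have J: "(\<forall>p\<in>J \<union> (\<lambda>(\<alpha>, j). (- \<alpha>, j)) ` J. y \<in> L_half E p) \<longleftrightarrow>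
      (\<forall>k. e k \<in> J \<longrightarrow> c_minus E $ jx k \<le> strs k y \<and> strs k y \<le> c_plus E $ jx k)"
    if "y \<in> V_space E" for y
  proof -
    \<comment> \<open>An element and its flip bound the stress from both sides, whichever sign comes
      first.\<close>
    have halves: "y \<in> L_half E (e k) \<and> y \<in> L_half E (- al k, jx k) \<longleftrightarrow>
        c_minus E $ jx k \<le> strs k y \<and> strs k y \<le> c_plus E $ jx k" for k
    proof -
      obtain \<alpha> j where ek: "e k = (\<alpha>, j)" by (cases "e k")
      then have "\<alpha> = 1 \<or> \<alpha> = -1" using sign_cases[of k] by simp
      then show ?thesis using that by (auto simp: ek L_half_def c_lim_def)
    qed
    have "(\<forall>p\<in>J \<union> (\<lambda>(\<alpha>, j). (- \<alpha>, j)) ` J. y \<in> L_half E p) \<longleftrightarrow>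
        (\<forall>p\<in>J. y \<in> L_half E p \<and> y \<in> L_half E (- fst p, snd p))"
      by fastforce
    also have "\<dots> \<longleftrightarrow> (\<forall>k. e k \<in> J \<longrightarrow> y \<in> L_half E (e k) \<and> y \<in> L_half E (- al k, jx k))"
      by (metis UnCI enum_obtain)
    also have "\<dots> \<longleftrightarrow> (\<forall>k. e k \<in> J \<longrightarrow> c_minus E $ jx k \<le> strs k y \<and> strs k y \<le> c_plus E $ jx k)"
      by (simp only: halves)
    finally show ?thesis .
  qed
  have "y \<in> F_set E I\<^sub>0 I M \<longleftrightarrow> y \<in> face" for y
  proof -
    have "y \<in> F_set E I\<^sub>0 I M \<longleftrightarrow> y \<in> V_space E \<and>
        (\<forall>k. e k \<in> I\<^sub>0 \<longrightarrow> strs k y = c_lim E (al k) (jx k)) \<and>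
        (\<forall>k. e k \<in> J \<longrightarrow> c_minus E $ jx k \<le> strs k y \<and> strs k y \<le> c_plus E $ jx k)"
      using F I0 J by blast
    also have "\<dots> \<longleftrightarrow> y \<in> V_space E \<and> (\<forall>k. lo $ k \<le> strs k y \<and> strs k y \<le> hi $ k)"
    proof -
      have "e k \<in> J \<longleftrightarrow> e k \<notin> I\<^sub>0" for k using enum_cases[of k] disjoint by blast
      then have "(\<forall>k. e k \<in> I\<^sub>0 \<longrightarrow> strs k y = c_lim E (al k) (jx k)) \<and>
        (\<forall>k. e k \<in> J \<longrightarrow> c_minus E $ jx k \<le> strs k y \<and> strs k y \<le> c_plus E $ jx k) \<longleftrightarrow>
        (\<forall>k. if e k \<in> I\<^sub>0 then strs k y = c_lim E (al k) (jx k)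
             else c_minus E $ jx k \<le> strs k y \<and> strs k y \<le> c_plus E $ jx k)"
        by auto
      also have "\<dots> \<longleftrightarrow> (\<forall>k. lo $ k \<le> strs k y \<and> strs k y \<le> hi $ k)"
        by (rule iff_allI) (auto simp: lo_def hi_def)
      finally show ?thesis by blast
    qed
    finally show ?thesis by (simp add: face_def)
  qed
  then show ?thesis by blast
qed

text \<open>A vertex selects one limit for each spring of \<open>J\<close>. Flipping the elements
  whose opposite limit is attained gives the family prescribing these values, and
  \<open>strs_unique\<close> leaves no other point.\<close>

lemma vertex_eq_y_star:
  assumes y: "y \<in> V_space E" and vertex: "\<And>k. strs k y = lo $ k \<or> strs k y = hi $ k"
  obtains J' where "J' \<in> sign_changes J" "y_star E I\<^sub>0 J' = y"
proof -
  \<comment> \<open>Flipping is tied to a violated equation, so nothing is flipped where both limits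
    coincide.\<close>
  define S where "S = {p \<in> J. \<exists>k. p = e k \<and> strs k y \<noteq> c_lim E (al k) (jx k)}"
  define J' where "J' = (J - S) \<union> (\<lambda>(\<alpha>, j). (- \<alpha>, j)) ` S"
  have inj: "e k = e k' \<Longrightarrow> k = k'" for k k'
    using enum by (metis UNIV_I bij_betw_def inj_onD)
  have "J' \<in> sign_changes J" unfolding sign_changes_def J'_def S_def by blast
  moreover have "y_star E I\<^sub>0 J' = y"
    unfolding y_star_def
  proof (rule the_equality)
    have "a_diag E $ j * y $ j = c_lim E \<alpha> j" if p: "(\<alpha>, j) \<in> I\<^sub>0 \<union> J'" for \<alpha> j
    proof -
      consider (plane) "(\<alpha>, j) \<in> I\<^sub>0" | (same) "(\<alpha>, j) \<in> J - S" | (flip) "(- \<alpha>, j) \<in> S"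
        using p by (auto simp: J'_def)
      then show ?thesis
      proof cases
        case plane
        then obtain k where k: "(\<alpha>, j) = e k" using enum_obtain by blast
        then show ?thesis
          using vertex[of k] plane by (auto simp: lo_def hi_def k[symmetric])
      next
        case same
        then obtain k where k: "(\<alpha>, j) = e k" using enum_obtain by blast
        then show ?thesis using same unfolding S_def by (metis (mono_tags, lifting) DiffE fst_conv mem_Collect_eq snd_conv)
      next
        case flip
        then obtain k where k: "e k = (- \<alpha>, j)" "(- \<alpha>, j) \<in> J" "strs k y \<noteq> c_lim E (- \<alpha>) j"
          by (auto simp: S_def) (metis fst_conv snd_conv)
        then have "e k \<notin> I\<^sub>0" using disjoint by auto
        then have "strs k y = c_minus E $ j \<or> strs k y = c_plus E $ j"
          using vertex[of k] k by (auto simp: lo_def hi_def)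
        moreover have "\<alpha> = 1 \<or> \<alpha> = -1" using sign_cases[of k] k by auto
        ultimately show ?thesis using k by (auto simp: c_lim_def split: if_splits)
      qed
    qed
    then show "y \<in> V_space E \<and> (\<forall>(\<alpha>, j)\<in>I\<^sub>0 \<union> J'. axis j 1 \<bullet> (A_mat E *v y) = c_lim E \<alpha> j)"
      using y by auto
    fix y' assume y': "y' \<in> V_space E \<and> (\<forall>(\<alpha>, j)\<in>I\<^sub>0 \<union> J'. axis j 1 \<bullet> (A_mat E *v y') = c_lim E \<alpha> j)"
    show "y' = y"
    proof (rule strs_unique)
      fix k
      obtain \<beta> where "(\<beta>, jx k) \<in> I\<^sub>0 \<union> J'"
      proof (cases "e k \<in> S")
        case True
        then have "(- al k, jx k) \<in> J'" unfolding J'_def by force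
        then show ?thesis using that by blast
      next
        case False
        then have "e k \<in> I\<^sub>0 \<union> J'" using enum_cases[of k] by (auto simp: J'_def)
        then show ?thesis using that[of "al k"] by simp
      qed
      then show "strs k y' = strs k y"
        using y' \<open>\<And>\<alpha> j. (\<alpha>, j) \<in> I\<^sub>0 \<union> J' \<Longrightarrow> a_diag E $ j * y $ j = c_lim E \<alpha> j\<close> by fastforce
    qed (use y y' in auto)
  qed
  ultimately show ?thesis by (rule that)
qed

text \<open>The linear inverse of the stress map carries \<open>cbox lo hi\<close> to the face and
  its vertices to points \<open>y_star\<close>, and linear maps commute with convex hulls.\<close>

lemma face_subset_convex_hull: "face \<subseteq> convex hull (y_star E I\<^sub>0 ` sign_changes J)"
proof
  fix y assume y: "y \<in> face"
  obtain point where pt: "linear point" "\<And>b. point b \<in> V_space E" "\<And>b k. strs k (point b) = b $ k"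
    using strs_prescribed by blast
  define vs where "vs = {b. \<forall>k. b $ k = lo $ k \<or> b $ k = hi $ k}"
  define b where "b = (\<chi> k. strs k y)"
  have "b \<in> cbox lo hi" using y by (simp add: b_def face_def mem_box_cart)
  then have "b \<in> convex hull vs" using cbox_subset_convex_hull_vertices unfolding vs_def by blast
  then have "point b \<in> convex hull (point ` vs)" using convex_hull_linear_image[OF pt(1)] by blast
  moreover have "point b = y"
    using y by (intro strs_unique pt(2)) (auto simp: pt(3) b_def face_def)
  moreover have "point ` vs \<subseteq> y_star E I\<^sub>0 ` sign_changes J"
  proof clarify
    fix v assume "v \<in> vs"
    then have "strs k (point v) = lo $ k \<or> strs k (point v) = hi $ k" for k
      by (simp add: vs_def pt(3))
    then obtain J' where "J' \<in> sign_changes J" "y_star E I\<^sub>0 J' = point v"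
      using vertex_eq_y_star pt(2) by metis
    then show "point v \<in> y_star E I\<^sub>0 ` sign_changes J" by (metis imageI)
  qed
  ultimately show "y \<in> convex hull (y_star E I\<^sub>0 ` sign_changes J)" by (metis hull_mono subsetD)
qed

lemma face_nonempty: "face \<noteq> {}"
proof -
  obtain point where "\<And>b. point b \<in> V_space E" "\<And>b k. strs k (point b) = b $ k"
    using strs_prescribed by metis
  then have "point lo \<in> face" using lo_le_hi by (simp add: face_def)
  then show ?thesis by blast
qed

lemma closed_face: "closed face" and convex_face: "convex face"
proof -
  have eq: "face = V_space E \<inter> (\<Inter>k. {y. lo $ k \<le> strs k y} \<inter> {y. strs k y \<le> hi $ k})"
    by (auto simp: face_def)
  show "closed face"
    unfolding eq
    by (intro closed_Int closed_INT ballI closed_subspace subspace_V closed_Collect_le continuous_intros)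
  have "convex ({y. lo $ k \<le> strs k y} \<inter> {y. strs k y \<le> hi $ k})" for k
  proof -
    have "strs k y = (a_diag E $ jx k *\<^sub>R axis (jx k) 1) \<bullet> y" for y by simp
    then show ?thesis
      by (simp only: convex_Int convex_halfspace_le convex_halfspace_ge)
  qed
  then have "convex (\<Inter>k. {y. lo $ k \<le> strs k y} \<inter> {y. strs k y \<le> hi $ k})"
    by (intro convex_INT)
  then show "convex face"
    unfolding eq by (intro convex_Int[OF subspace_imp_convex[OF subspace_V]])
qed

section \<open>The projection \<open>L_mat\<close> and the shifted normal cone\<close>

lemma L_mat_mult:
  "L_mat E I\<^sub>0 e *v x = (\<Sum>k | e k \<in> I\<^sub>0. coord x $ k *\<^sub>R n_vec E (jx k))"
proof -
  have "(L_mat E I\<^sub>0 e *v x) $ i = (\<Sum>k | e k \<in> I\<^sub>0. coord x $ k * n_vec E (jx k) $ i)" for i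
  proof -
    have "(L_mat E I\<^sub>0 e *v x) $ i =
      (\<Sum>j\<in>UNIV. \<Sum>k | e k \<in> I\<^sub>0. n_vec E (jx k) $ i * (matrix_inv G_mat ** P_mat E) $ k $ j * x $ j)"
      by (simp add: L_mat_def matrix_vector_mult_def Let_def sum_distrib_right flip: G_mat_def)
    also have "\<dots> = (\<Sum>k | e k \<in> I\<^sub>0. \<Sum>j\<in>UNIV. n_vec E (jx k) $ i * (matrix_inv G_mat ** P_mat E) $ k $ j * x $ j)"
      by (rule sum.swap)
    also have "\<dots> = (\<Sum>k | e k \<in> I\<^sub>0. n_vec E (jx k) $ i * ((matrix_inv G_mat ** P_mat E) *v x) $ k)"
      by (simp add: matrix_vector_mult_def sum_distrib_left mult.assoc)
    also have "\<dots> = (\<Sum>k | e k \<in> I\<^sub>0. coord x $ k * n_vec E (jx k) $ i)"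
      by (simp add: coord_def matrix_vector_mul_assoc mult.commute)
    finally show ?thesis .
  qed
  then show ?thesis by (simp add: vec_eq_iff)
qed

text \<open>On \<open>V_space E\<close>, \<open>L_mat\<close> is the projection that keeps the
  \<open>I\<^sub>0\<close> part of the expansion in normals. Conjugating with \<open>sqrt_A\<close>
  turns its energy norm into a Euclidean one, which \<open>norm_le_sqrt_Max_eigenvalues\<close>
  bounds.\<close>

lemma norm_A_L_mat_le:
  "norm_A E (L_mat E I\<^sub>0 e *v x) \<le> sqrt (sigma_max E I\<^sub>0 e) * norm_A E x"
proof -
  define D where "D = diag_matrix (\<chi> j. sqrt (inverse (a_diag E $ j)))"
  define S where "S = sqrt_A ** L_mat E I\<^sub>0 e ** D"
  have "D *v (sqrt_A *v x) = x"
  proof -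
    have "sqrt (inverse (a_diag E $ j)) * (sqrt (a_diag E $ j) * x $ j) = x $ j" for j
      using stiffness_pos[of j] by (simp add: real_sqrt_inverse)
    then show ?thesis by (simp add: vec_eq_iff D_def sqrt_A_def)
  qed
  then have "S *v (sqrt_A *v x) = sqrt_A *v (L_mat E I\<^sub>0 e *v x)"
    by (simp add: S_def flip: matrix_vector_mul_assoc)
  moreover have "sigma_max E I\<^sub>0 e = Max (eigenvalues (transpose S ** S))"
    by (simp add: sigma_max_def S_def D_def sqrt_A_def Let_def)
  ultimately show ?thesis
    using norm_le_sqrt_Max_eigenvalues[of S "sqrt_A *v x"] by (simp add: norm_sqrt_A)
qed

text \<open>\<open>L_mat\<close> fixes the normals belonging to \<open>I\<^sub>0\<close>, and these
  are nonzero. The bound makes division by \<open>smax\<close> legitimate.\<close>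

lemma sigma_max_ge_1: "1 \<le> sqrt (sigma_max E I\<^sub>0 e)"
proof -
  obtain k where k: "e k \<in> I\<^sub>0" using nonempty by (metis UnCI enum_obtain ex_in_conv)
  let ?n = "n_vec E (jx k)"
  have "L_mat E I\<^sub>0 e *v ?n = (\<Sum>k' | e k' \<in> I\<^sub>0. if k' = k then ?n else 0)"
    unfolding L_mat_mult coord_n_vec by (rule sum.cong) (auto simp: axis_def)
  then have "L_mat E I\<^sub>0 e *v ?n = ?n" using k by simp
  then have "norm_A E ?n \<le> sqrt (sigma_max E I\<^sub>0 e) * norm_A E ?n"
    using norm_A_L_mat_le[of ?n] by simp
  moreover have "?n \<noteq> 0"
  proof
    assume "?n = 0"
    then have "axis k (1::real) = 0" using coord_n_vec[of k] by (simp add: coord_def)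
    then show False by simp
  qed
  then have "norm_A E ?n > 0" using norm_A_nonneg norm_A_eq_0_iff by (metis less_le)
  ultimately show ?thesis by simp
qed

text \<open>If the sum of the coefficients at \<open>k\<close> were of the wrong sign, then moving from \<open>w\<close> by a proper
  fraction of the \<open>I\<^sub>0\<close>-part of \<open>x\<close>, whose norm is at most \<open>\<epsilon>\<close>, would already reach the span of the other
  normals.\<close>

lemma coord_sum_sign:
  assumes w: "w \<in> V_space E" "\<And>k. e k \<in> I\<^sub>0 \<Longrightarrow> al k * coord w $ k \<ge> 0" "\<And>k. e k \<notin> I\<^sub>0 \<Longrightarrow> coord w $ k = 0"
    and dist: "\<And>p. p \<in> I\<^sub>0 \<Longrightarrow> \<epsilon> \<le> dist_A E w (span ((\<lambda>(\<alpha>, j). n_vec E j) ` (I\<^sub>0 - {p})))"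
    and x: "norm_A E (L_mat E I\<^sub>0 e *v x) \<le> \<epsilon>" and "\<epsilon> > 0" and k: "e k \<in> I\<^sub>0"
  shows "al k * (coord w $ k + coord x $ k) \<ge> 0"
proof (rule ccontr)
  define u v where "u = al k * coord w $ k" and "v = al k * coord x $ k"
  assume "\<not> ?thesis"
  then have neg: "u + v < 0" by (simp add: u_def v_def distrib_left)
  have "u \<ge> 0" using w(2)[OF k] by (simp add: u_def)
  \<comment> \<open>The fraction at which the coefficient at \<open>k\<close> vanishes;
    \<open>u \<ge> 0\<close> and \<open>u + v < 0\<close> give \<open>v < 0\<close> and
    \<open>\<theta> < 1\<close>.\<close>
  define \<theta> where "\<theta> = u / (- v)"
  have \<theta>: "0 \<le> \<theta>" "\<theta> < 1" "u + \<theta> * v = 0" using neg \<open>u \<ge> 0\<close> by (auto simp: \<theta>_def field_simps)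
  define z where "z = w + \<theta> *\<^sub>R (L_mat E I\<^sub>0 e *v x)"
  have "w = (\<Sum>k | e k \<in> I\<^sub>0. coord w $ k *\<^sub>R n_vec E (jx k))"
    by (subst coord_expansion[OF w(1)], rule sum.mono_neutral_right) (auto simp: w(3))
  then have z: "z = (\<Sum>k' | e k' \<in> I\<^sub>0. (coord w $ k' + \<theta> * coord x $ k') *\<^sub>R n_vec E (jx k'))"
    unfolding z_def L_mat_mult by (simp add: scaleR_sum_right scaleR_add_left sum.distrib)
  have "z \<in> span ((\<lambda>(\<alpha>, j). n_vec E j) ` (I\<^sub>0 - {e k}))"
    unfolding z
  proof (rule span_sum)
    fix k' assume "k' \<in> {k'. e k' \<in> I\<^sub>0}"
    then have k': "e k' \<in> I\<^sub>0" by simp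
    show "(coord w $ k' + \<theta> * coord x $ k') *\<^sub>R n_vec E (jx k') \<in> span ((\<lambda>(\<alpha>, j). n_vec E j) ` (I\<^sub>0 - {e k}))"
    proof (cases "e k' = e k")
      case True
      then have "k' = k" using enum by (metis UNIV_I bij_betw_def inj_onD)
      have "al k * (coord w $ k + \<theta> * coord x $ k) = 0"
        using \<theta>(3) by (simp add: u_def v_def algebra_simps)
      then have "coord w $ k + \<theta> * coord x $ k = 0" using sign_cases[of k] by auto
      then show ?thesis by (simp add: \<open>k' = k\<close> span_zero)
    next
      case False
      then have "n_vec E (jx k') \<in> (\<lambda>(\<alpha>, j). n_vec E j) ` (I\<^sub>0 - {e k})"
        using k' by (force simp: case_prod_unfold)
      then show ?thesis by (intro span_scale span_base)
    qed
  qed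
  then have "\<epsilon> \<le> norm_A E (w - z)" using dist[OF k] dist_A_le order_trans by blast
  also have "w - z = (- \<theta>) *\<^sub>R (L_mat E I\<^sub>0 e *v x)" by (simp add: z_def)
  also have "norm_A E \<dots> = \<theta> * norm_A E (L_mat E I\<^sub>0 e *v x)" unfolding norm_A_scaleR using \<theta>(1) by simp
  also have "\<dots> \<le> \<theta> * \<epsilon>" using x \<theta>(1) by (rule mult_left_mono)
  also have "\<dots> < \<epsilon>" using \<theta>(2) \<open>\<epsilon> > 0\<close> by simp
  finally show False by simp
qed

text \<open>By duality the scalar product is a sum over springs, and each term is nonpositive by
  itself. On \<open>I\<^sub>0\<close> the coefficient has the outward sign by
  \<open>coord_sum_sign\<close> and \<open>y\<close> sits at the limit; elsewhere only
  \<open>x\<close> contributes, and normality to the face controls it.\<close>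

lemma shifted_normal_cone:
  assumes w: "w \<in> V_space E" "\<And>k. e k \<in> I\<^sub>0 \<Longrightarrow> al k * coord w $ k \<ge> 0" "\<And>k. e k \<notin> I\<^sub>0 \<Longrightarrow> coord w $ k = 0"
    and dist: "\<And>p. p \<in> I\<^sub>0 \<Longrightarrow> \<epsilon> \<le> dist_A E w (span ((\<lambda>(\<alpha>, j). n_vec E j) ` (I\<^sub>0 - {p})))"
    and L: "norm_A E (L_mat E I\<^sub>0 e *v x) \<le> \<epsilon>" and "\<epsilon> > 0"
    and y: "y \<in> face" and x: "x \<in> normal_cone_A E face y" and sub: "face \<subseteq> C_set E"
  shows "w + x \<in> normal_cone_A E (C_set E) y"
proof -
  have xV: "x \<in> V_space E" and xn: "\<And>\<xi>. \<xi> \<in> face \<Longrightarrow> x \<bullet> (A_mat E *v (\<xi> - y)) \<le> 0"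
    using x y by (auto simp: normal_cone_A_def)
  have yV: "y \<in> V_space E" using y by (simp add: face_def)
  have wxV: "w + x \<in> V_space E" using w(1) xV subspace_V by (simp add: subspace_add)
  have "(w + x) \<bullet> (A_mat E *v (\<xi> - y)) \<le> 0" if \<xi>: "\<xi> \<in> C_set E" for \<xi>
  proof -
    have \<xi>V: "\<xi> - y \<in> V_space E" using \<xi> yV subspace_V by (simp add: C_set_def subspace_diff)
    have \<xi>b: "c_minus E $ jx k \<le> strs k \<xi>" "strs k \<xi> \<le> c_plus E $ jx k" for k
      using \<xi> by (auto simp: C_set_def)
    have "(coord w $ k + coord x $ k) * strs k (\<xi> - y) \<le> 0" for k
    proof (cases "e k \<in> I\<^sub>0")
      case True
      have "al k * (coord w $ k + coord x $ k) \<ge> 0"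
        by (rule coord_sum_sign[OF w dist L \<open>\<epsilon> > 0\<close> True])
      moreover have "lo $ k \<le> strs k y \<and> strs k y \<le> hi $ k" using y by (simp add: face_def)
      then have "strs k y = c_lim E (al k) (jx k)" using True by (simp add: lo_def hi_def)
      moreover have "strs k (\<xi> - y) = strs k \<xi> - strs k y" by (simp add: right_diff_distrib)
      ultimately show ?thesis
        using \<xi>b[of k] sign_cases[of k]
        by (elim disjE) (auto simp only: mult_le_0_iff, auto simp: c_lim_def)
    next
      case False
      obtain point where pt: "\<And>b. point b \<in> V_space E" "\<And>b k. strs k (point b) = b $ k"
        using strs_prescribed by metis
      \<comment> \<open>Changes the stress at \<open>k\<close> alone, to that of
        \<open>\<xi>\<close>. Outside \<open>I\<^sub>0\<close> the box allows the full elastic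
        range, so \<open>y + v\<close> stays in the face and can test \<open>x\<close>.\<close>
      define v where "v = point (axis k (strs k \<xi> - strs k y))"
      have v: "strs k' v = (if k' = k then strs k \<xi> - strs k y else 0)" for k'
        unfolding v_def pt(2) by (simp add: axis_def)
      have "y + v \<in> face"
      proof -
        have "lo $ k' \<le> strs k' (y + v) \<and> strs k' (y + v) \<le> hi $ k'" for k'
        proof -
          have "lo $ k' \<le> strs k' y \<and> strs k' y \<le> hi $ k'" using y by (simp add: face_def)
          then show ?thesis
            unfolding distrib_left vector_add_component v
            using \<xi>b[of k] False by (cases "k' = k") (simp_all add: lo_def hi_def)
        qed
        moreover have "y + v \<in> V_space E"
          unfolding v_def using yV pt(1) subspace_V by (simp add: subspace_add)
        ultimately show ?thesis by (simp add: face_def)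
      qed
      then have "x \<bullet> (A_mat E *v v) \<le> 0" using xn[of "y + v"] by simp
      moreover have "x \<bullet> (A_mat E *v v) = (\<Sum>k'\<in>UNIV. if k' = k then coord x $ k * (strs k \<xi> - strs k y) else 0)"
        unfolding inner_A_coord[OF xV pt(1)[of "axis k (strs k \<xi> - strs k y)", folded v_def]] v
        by (rule sum.cong) auto
      ultimately show ?thesis using w(3)[OF False] by (simp add: right_diff_distrib)
    qed
    then have "(\<Sum>k\<in>UNIV. coord (w + x) $ k * strs k (\<xi> - y)) \<le> 0"
      unfolding coord_add vector_add_component by (intro sum_nonpos) blast
    then show ?thesis unfolding inner_A_coord[OF wxV \<xi>V] .
  qed
  then show ?thesis using y sub wxV by (auto simp: normal_cone_A_def)
qed

text \<open>The sign conditions define a convex cone, and a generator has a single nonzero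
  coordinate, equal to its own sign. The lemma serves for the vector \<open>- c'\<close>.\<close>

lemma coord_lift_cone:
  assumes "v \<in> convex_cone hull ((\<lambda>(\<alpha>, j). P_mat E *v (\<alpha> *\<^sub>R axis j 1)) ` I\<^sub>0)"
  shows "if e k \<in> I\<^sub>0 then al k * coord (lift v) $ k \<ge> 0 else coord (lift v) $ k = 0"
proof -
  define ok where "ok v k \<longleftrightarrow> (if e k \<in> I\<^sub>0 then al k * (matrix_inv G_mat *v v) $ k \<ge> 0
      else (matrix_inv G_mat *v v) $ k = 0)" for v k
  define K where "K = {v. \<forall>k. ok v k}"
  have "ok (x + y) k" if "ok x k" "ok y k" for x y k
    using that by (auto simp: ok_def matrix_vector_right_distrib distrib_left split: if_splits)
  moreover have "ok (c *\<^sub>R x) k" if "ok x k" "0 \<le> c" for x c k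
    using that by (auto simp: ok_def matrix_vector_mult_scaleR mult.left_commute[of "al k"] split: if_splits)
  moreover have "ok 0 k" for k by (simp add: ok_def)
  ultimately have "convex_cone K" by (auto simp: convex_cone_iff K_def)
  moreover have "(\<lambda>(\<alpha>, j). P_mat E *v (\<alpha> *\<^sub>R axis j 1)) ` I\<^sub>0 \<subseteq> K"
  proof clarify
    fix \<alpha> j assume I0: "(\<alpha>, j) \<in> I\<^sub>0"
    then obtain k where k: "(\<alpha>, j) = e k" using enum_obtain by blast
    then have "matrix_inv G_mat *v (P_mat E *v (\<alpha> *\<^sub>R axis j 1)) = \<alpha> *\<^sub>R axis k 1"
      using matrix_inv_G_column[of k] by (metis matrix_vector_mult_scaleR snd_conv)
    moreover have "al k = \<alpha>" "e k \<in> I\<^sub>0" using k I0 by (metis fst_conv, simp)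
    ultimately show "P_mat E *v (\<alpha> *\<^sub>R axis j 1) \<in> K" by (auto simp: K_def ok_def axis_def)
  qed
  ultimately have "v \<in> K" using assms hull_minimal by blast
  then show ?thesis by (simp add: K_def ok_def coord_def P_lift)
qed

text \<open>Springs in \<open>range jx\<close> are limited by the box itself. For any other spring
  the limits describe a convex slab that contains all vertices, hence their hull.\<close>

lemma face_subset_C:
  assumes "\<And>J' j. J' \<in> sign_changes J \<Longrightarrow> j \<notin> range jx \<Longrightarrow>
      c_minus E $ j \<le> a_diag E $ j * y_star E I\<^sub>0 J' $ j \<and> a_diag E $ j * y_star E I\<^sub>0 J' $ j \<le> c_plus E $ j"
  shows "face \<subseteq> C_set E"
proof
  fix y assume y: "y \<in> face"
  have "c_minus E $ j \<le> a_diag E $ j * y $ j \<and> a_diag E $ j * y $ j \<le> c_plus E $ j" for j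
  proof (cases "j \<in> range jx")
    case True
    then obtain k where k: "j = jx k" by blast
    then show ?thesis
      using y c_minus_le_lo[of k] hi_le_c_plus[of k] by (auto simp: face_def intro: order_trans)
  next
    case False
    define H :: "(real^'m) set" where "H = {y. (a_diag E $ j *\<^sub>R axis j 1) \<bullet> y \<ge> c_minus E $ j} \<inter> {y. (a_diag E $ j *\<^sub>R axis j 1) \<bullet> y \<le> c_plus E $ j}"
    have "convex H" unfolding H_def by (intro convex_Int convex_halfspace_ge convex_halfspace_le)
    moreover have "y_star E I\<^sub>0 ` sign_changes J \<subseteq> H" using assms False by (auto simp: H_def)
    ultimately have "y \<in> H" using face_subset_convex_hull y hull_minimal by blast
    then show ?thesis by (simp add: H_def)
  qed
  then show "y \<in> C_set E" using y by (simp add: C_set_def face_def)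
qed

section \<open>Solutions reach the face in finite time\<close>

lemma approach_speed:
  assumes "\<epsilon> \<ge> 0" and sub: "face \<subseteq> C_set E"
    and incl: "\<And>\<zeta> v. \<zeta> \<in> face \<Longrightarrow> v \<in> ball_A E \<epsilon> \<inter> normal_cone_A E face \<zeta> \<Longrightarrow> w + v \<in> normal_cone_A E (C_set E) \<zeta>"
    and x: "x \<in> C_set E" and y': "- y' \<in> normal_cone_A E (C_set E) x"
    and \<zeta>: "\<zeta> \<in> face" and obtuse: "\<And>\<eta>. \<eta> \<in> face \<Longrightarrow> (x - \<zeta>) \<bullet> (A_mat E *v (\<eta> - \<zeta>)) \<le> 0"
  shows "(y' + w) \<bullet> (A_mat E *v (x - \<zeta>)) \<le> - \<epsilon> * norm_A E (x - \<zeta>)"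
proof (cases "x = \<zeta>")
  case False
  define \<rho> where "\<rho> = norm_A E (x - \<zeta>)"
  have "\<rho> > 0" using False norm_A_nonneg norm_A_eq_0_iff by (metis \<rho>_def eq_iff_diff_eq_0 less_le)
  have sq: "(x - \<zeta>) \<bullet> (A_mat E *v (x - \<zeta>)) = \<rho> * \<rho>"
    by (simp add: \<rho>_def power2_norm_eq_inner inner_sqrt_A flip: norm_sqrt_A power2_eq_square)
  have V: "x - \<zeta> \<in> V_space E"
    using x \<zeta> subspace_V by (simp add: C_set_def face_def subspace_diff)
  \<comment> \<open>The outward direction rescaled to norm \<open>\<epsilon>\<close>;
    \<open>obtuse\<close> makes it normal to the face at \<open>\<zeta>\<close>.\<close>
  define v where "v = (\<epsilon> / \<rho>) *\<^sub>R (x - \<zeta>)"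
  have vV: "v \<in> V_space E" unfolding v_def using V subspace_V by (rule subspace_scale[rotated])
  have "norm_A E v = \<epsilon>"
    unfolding v_def norm_A_scaleR using \<open>\<rho> > 0\<close> \<open>\<epsilon> \<ge> 0\<close> by (simp flip: \<rho>_def)
  moreover have "v \<bullet> (A_mat E *v (\<eta> - \<zeta>)) \<le> 0" if "\<eta> \<in> face" for \<eta>
    unfolding v_def inner_scaleR_left using obtuse[OF that] \<open>\<rho> > 0\<close> \<open>\<epsilon> \<ge> 0\<close>
    by (intro mult_nonneg_nonpos) auto
  ultimately have "v \<in> ball_A E \<epsilon> \<inter> normal_cone_A E face \<zeta>"
    using vV \<zeta> by (simp add: ball_A_def normal_cone_A_def)
  then have "(w + v) \<bullet> (A_mat E *v (x - \<zeta>)) \<le> 0"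
    using incl[OF \<zeta>, of v] x by (simp add: normal_cone_A_def split: if_splits)
  moreover have "v \<bullet> (A_mat E *v (x - \<zeta>)) = \<epsilon> * \<rho>"
    unfolding v_def inner_scaleR_left sq using \<open>\<rho> > 0\<close> by simp
  \<comment> \<open>The roles are now exchanged: \<open>\<zeta>\<close> tests the normal
    \<open>- y'\<close> at \<open>x\<close>, whereas before \<open>x\<close> tested
    \<open>w + v\<close> at \<open>\<zeta>\<close>.\<close>
  moreover have "(- y') \<bullet> (A_mat E *v (\<zeta> - x)) \<le> 0"
    using y' x \<zeta> sub by (auto simp: normal_cone_A_def split: if_splits)
  then have "y' \<bullet> (A_mat E *v (x - \<zeta>)) \<le> 0"
    by (simp add: matrix_vector_mult_diff_distrib inner_diff_right)
  ultimately show ?thesis by (simp add: inner_add_left \<rho>_def)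
qed (simp add: norm_A_def)

text \<open>\<open>finite_time_arrival\<close> is applied to the image of \<open>y - c\<close> under
  \<open>sqrt_A\<close>, where energy distances are Euclidean. The vector
  \<open>lift (deriv (load E) t *\<^sub>R axis None 1)\<close> is \<open>- c'\<close>.\<close>

lemma arrival_in_face:
  assumes "\<epsilon> \<ge> 0" "\<tau> \<ge> 0" and sub: "face \<subseteq> C_set E"
    and incl: "AE t in lebesgue. t \<in> {0..\<tau>} \<longrightarrow> load E differentiable (at t) \<and>
      (\<forall>\<zeta>\<in>face. \<forall>v\<in>ball_A E \<epsilon> \<inter> normal_cone_A E face \<zeta>.
        lift (deriv (load E) t *\<^sub>R axis None 1) + v \<in> normal_cone_A E (C_set E) \<zeta>)"
    and time: "norm_A E (matrix_inv (A_mat E) *v c_plus E - matrix_inv (A_mat E) *v c_minus E) \<le> \<epsilon> * \<tau>"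
    and y: "sweeping_solution E y"
  shows "y \<tau> - c_shift E \<tau> \<in> face"
proof -
  define x where "x t = y t - c_shift E t" for t
  have lin: "linear ((*v) sqrt_A)" by (rule matrix_vector_mul_linear)
  have inj: "inj ((*v) sqrt_A)"
    using sqrt_A_eq_0_iff by (simp add: linear_injective_0[OF lin])
  have xC: "x t \<in> C_set E" if "t \<ge> 0" for t
    using y that by (auto simp: sweeping_solution_def moved_def x_def)
  define good where "good t \<longleftrightarrow> (t \<in> {0..\<tau>} \<longrightarrow> (load E differentiable (at t) \<and>
      (\<forall>\<zeta>\<in>face. \<forall>v\<in>ball_A E \<epsilon> \<inter> normal_cone_A E face \<zeta>.
        lift (deriv (load E) t *\<^sub>R axis None 1) + v \<in> normal_cone_A E (C_set E) \<zeta>)) \<and>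
      (\<exists>y'. (y has_vector_derivative y') (at t) \<and> - y' \<in> normal_cone_A E (moved E (C_set E) t) (y t)))" for t
  have "AE t in lebesgue. 0 \<le> t \<longrightarrow> (\<exists>y'. (y has_vector_derivative y') (at t) \<and>
      - y' \<in> normal_cone_A E (moved E (C_set E) t) (y t))"
    using y by (simp add: sweeping_solution_def)
  with incl have "AE t in lebesgue. good t" by eventually_elim (auto simp: good_def)
  then obtain N where "N \<in> null_sets lebesgue" "{t \<in> space lebesgue. \<not> good t} \<subseteq> N"
    unfolding eventually_ae_filter by blast
  then have N: "negligible N" "\<And>t. t \<notin> N \<Longrightarrow> good t"
    by (auto simp: negligible_iff_null_sets)
  have "sqrt_A *v x \<tau> \<in> (*v) sqrt_A ` face"
  proof (rule finite_time_arrival[where N = N and \<epsilon> = \<epsilon> and \<tau> = \<tau> and z = "\<lambda>t. sqrt_A *v x t"])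
    show "convex ((*v) sqrt_A ` face)" by (rule convex_linear_image[OF lin convex_face])
    show "closed ((*v) sqrt_A ` face)" by (rule closed_injective_linear_image[OF closed_face lin inj])
    show "(*v) sqrt_A ` face \<noteq> {}" using face_nonempty by simp
    have "abs_cont_on_interval 0 \<tau> (\<lambda>t. - c_shift E t)"
      by (rule abs_cont_lipschitz_compose[where g = uminus and L = 1, OF abs_cont_c_shift])
        (simp add: norm_minus_commute)
    then have "abs_cont_on_interval 0 \<tau> x"
      unfolding x_def[abs_def] diff_conv_add_uminus using y \<open>\<tau> \<ge> 0\<close>
      by (intro abs_cont_add) (auto simp: sweeping_solution_def)
    then show "abs_cont_on_interval 0 \<tau> (\<lambda>t. sqrt_A *v x t)"
    proof (rule abs_cont_lipschitz_compose)
      show "norm (sqrt_A *v u - sqrt_A *v v) \<le> onorm ((*v) sqrt_A) * norm (u - v)" for u v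
        unfolding matrix_vector_mult_diff_distrib[symmetric]
        by (rule onorm[OF matrix_vector_mul_bounded_linear])
    qed
    \<comment> \<open>Any point of the face suffices: it lies in \<open>C_set E\<close>, as does
      \<open>x 0\<close>, so the diameter bound applies.\<close>
    obtain \<zeta> where \<zeta>: "\<zeta> \<in> face" using face_nonempty by blast
    have "infdist (sqrt_A *v x 0) ((*v) sqrt_A ` face) \<le> dist (sqrt_A *v x 0) (sqrt_A *v \<zeta>)"
      using \<zeta> by (intro infdist_le) simp
    also have "\<dots> = norm_A E (x 0 - \<zeta>)"
      by (simp add: dist_norm norm_sqrt_A flip: matrix_vector_mult_diff_distrib)
    also have "\<dots> \<le> \<epsilon> * \<tau>"
      using norm_A_diff_C_le[OF xC[OF order_refl], of \<zeta>] \<zeta> sub time by auto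
    finally show "infdist (sqrt_A *v x 0) ((*v) sqrt_A ` face) \<le> \<epsilon> * \<tau>" .
    fix t assume t: "t \<in> {0..\<tau>} - N"
    then have load: "load E differentiable (at t)"
      "\<And>\<zeta> v. \<zeta> \<in> face \<Longrightarrow> v \<in> ball_A E \<epsilon> \<inter> normal_cone_A E face \<zeta> \<Longrightarrow>
        lift (deriv (load E) t *\<^sub>R axis None 1) + v \<in> normal_cone_A E (C_set E) \<zeta>"
      using N(2)[of t] unfolding good_def by auto
    obtain y' where y': "(y has_vector_derivative y') (at t)" "- y' \<in> normal_cone_A E (moved E (C_set E) t) (y t)"
      using N(2)[of t] t unfolding good_def by auto
    define w where "w = lift (deriv (load E) t *\<^sub>R axis None 1)"
    have "(x has_vector_derivative y' - - w) (at t)"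
      unfolding x_def[abs_def] w_def
      by (intro has_vector_derivative_diff y'(1) c_shift_has_vector_derivative load(1))
    then have der: "((\<lambda>t. sqrt_A *v x t) has_vector_derivative sqrt_A *v (y' + w)) (at t)"
      using bounded_linear.has_vector_derivative[OF matrix_vector_mul_bounded_linear] by fastforce
    have xt: "x t \<in> C_set E" using xC t by auto
    \<comment> \<open>Translation by \<open>- c_shift E t\<close> takes the moving set to
      \<open>C_set E\<close> and \<open>y t\<close> to \<open>x t\<close>, and leaves normal vectors
      unchanged.\<close>
    have y'C: "- y' \<in> normal_cone_A E (C_set E) (x t)"
    proof -
      have "- y' \<in> V_space E" and *: "\<And>\<xi>. \<xi> \<in> moved E (C_set E) t \<Longrightarrow> (- y') \<bullet> (A_mat E *v (\<xi> - y t)) \<le> 0"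
        using y'(2) by (auto simp: normal_cone_A_def split: if_splits)
      moreover have "(- y') \<bullet> (A_mat E *v (\<xi> - x t)) \<le> 0" if "\<xi> \<in> C_set E" for \<xi>
        using *[of "\<xi> + c_shift E t"] that by (simp add: moved_def x_def algebra_simps)
      ultimately show ?thesis using xt by (simp add: normal_cone_A_def)
    qed
    have "(sqrt_A *v (y' + w)) \<bullet> (sqrt_A *v x t - \<xi>) \<le> - \<epsilon> * norm (sqrt_A *v x t - \<xi>)"
      if \<xi>: "\<xi> \<in> (*v) sqrt_A ` face" and obt: "\<forall>\<zeta>\<in>(*v) sqrt_A ` face. (sqrt_A *v x t - \<xi>) \<bullet> (\<zeta> - \<xi>) \<le> 0" for \<xi>
    proof -
      obtain \<zeta> where \<zeta>: "\<zeta> \<in> face" "\<xi> = sqrt_A *v \<zeta>" using \<xi> by blast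
      have "(x t - \<zeta>) \<bullet> (A_mat E *v (\<eta> - \<zeta>)) \<le> 0" if "\<eta> \<in> face" for \<eta>
        using obt that by (simp add: \<zeta>(2) inner_sqrt_A flip: matrix_vector_mult_diff_distrib)
      then have "(y' + w) \<bullet> (A_mat E *v (x t - \<zeta>)) \<le> - \<epsilon> * norm_A E (x t - \<zeta>)"
        using load(2) unfolding w_def[symmetric]
        by (intro approach_speed[OF \<open>\<epsilon> \<ge> 0\<close> sub _ xt y'C \<zeta>(1)])
      then show ?thesis
        by (simp add: \<zeta>(2) inner_sqrt_A norm_sqrt_A flip: matrix_vector_mult_diff_distrib)
    qed
    then show "\<exists>z'. ((\<lambda>t. sqrt_A *v x t) has_vector_derivative z') (at t) \<and>
        (\<forall>\<xi>\<in>(*v) sqrt_A ` face. (\<forall>\<zeta>\<in>(*v) sqrt_A ` face. (sqrt_A *v x t - \<xi>) \<bullet> (\<zeta> - \<xi>) \<le> 0) \<longrightarrow>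
          z' \<bullet> (sqrt_A *v x t - \<xi>) \<le> - \<epsilon> * norm (sqrt_A *v x t - \<xi>))"
      using der by blast
  qed (use assms N in auto)
  then show ?thesis using inj by (simp add: inj_image_mem_iff x_def)
qed

end

section \<open>Assembly in the coordinates of the family \<open>I 1\<close>\<close>

theorem proposition5:
  fixes E :: "('m::finite, 'n::finite, 'p::finite) elastoplastic"
    and I\<^sub>0 :: "(real \<times> 'm) set"
    and I :: "nat \<Rightarrow> (real \<times> 'm) set"
    and e :: "nat \<Rightarrow> 'p option \<Rightarrow> real \<times> 'm"
    and d M :: nat
    and \<tau> \<epsilon>\<^sub>0 smax :: real
  assumes "elastoplastic_system E"
    and "d = CARD('m) - CARD('n) + 2"
    and "I\<^sub>0 \<subseteq> {-1, 1} \<times> UNIV" and "I\<^sub>0 \<noteq> {}" and "card I\<^sub>0 < d"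
    and "I 1 \<subseteq> {-1, 1} \<times> UNIV" and "card I\<^sub>0 + card (I 1) = d"
    and "dim ((\<lambda>(\<alpha>, j). P_mat E *v (\<alpha> *\<^sub>R axis j 1)) ` (I\<^sub>0 \<union> I 1)) = d"
    and "M = 2 ^ (d - card I\<^sub>0)" and "bij_betw I {1..M} (sign_changes (I 1))"
    and "\<And>i. i \<in> {1..M} \<Longrightarrow> bij_betw (e i) UNIV (I\<^sub>0 \<union> I i)"
    and "\<tau> > 0"
    and "AE t in lebesgue. t \<in> {0..\<tau>} \<longrightarrow>
           load E differentiable (at t) \<and>
           deriv (load E) t *\<^sub>R axis None 1
             \<in> convex_cone hull ((\<lambda>(\<alpha>, j). P_mat E *v (\<alpha> *\<^sub>R axis j 1)) ` I\<^sub>0)"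
    and "\<And>i j. i \<in> {1..M} \<Longrightarrow> j \<notin> snd ` (I\<^sub>0 \<union> (\<Union>k\<in>{1..M}. I k)) \<Longrightarrow>
           c_minus E $ j < axis j 1 \<bullet> (A_mat E *v y_star E I\<^sub>0 (I i)) \<and>
           axis j 1 \<bullet> (A_mat E *v y_star E I\<^sub>0 (I i)) < c_plus E $ j"
    and "\<epsilon>\<^sub>0 > 0"
    and "AE t in lebesgue. t \<in> {0..\<tau>} \<longrightarrow> \<epsilon>\<^sub>0 \<le> eps_bar E I\<^sub>0 t"
    and "smax = Max ((\<lambda>i. sqrt (sigma_max E I\<^sub>0 (e i))) ` {1..M})"
    and "\<tau> \<ge> smax / \<epsilon>\<^sub>0 *
           norm_A E (matrix_inv (A_mat E) *v c_plus E - matrix_inv (A_mat E) *v c_minus E)"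
  shows "(AE t in lebesgue. t \<in> {0..\<tau>} \<longrightarrow>
            (\<forall>y\<in>F_set E I\<^sub>0 I M.
               (\<lambda>x. - vector_derivative (c_shift E) (at t) + x) `
                 (ball_A E (\<epsilon>\<^sub>0 / smax) \<inter> normal_cone_A E (F_set E I\<^sub>0 I M) y)
               \<subseteq> normal_cone_A E (C_set E) y)) \<and>
         (\<forall>y. sweeping_solution E y \<and> y 0 \<in> moved E (C_set E) 0 \<longrightarrow>
            y \<tau> \<in> moved E (F_set E I\<^sub>0 I M) \<tau> \<and>
            stress E y \<tau> \<in> convex hull ((\<lambda>i. A_mat E *v y_star E I\<^sub>0 (I i)) ` {1..M}))"
proof -
  note sys = assms(1) and d = assms(2) and smax = assms(17)
  have one: "1 \<in> {1..M}" using assms(9) by simp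
  have dcard: "d = CARD('p option)"
    using sys d by (auto simp: elastoplastic_system_def card_UNIV_option)
  have fin: "finite I\<^sub>0" "finite (I 1)"
    using assms(3,6) by (auto intro: finite_subset[of _ "{-1, 1} \<times> UNIV"])
  \<comment> \<open>The enumeration \<open>e 1\<close> gives the union \<open>d\<close> elements, as
    many as both cardinalities together, which leaves no room for an overlap.\<close>
  have "card (I\<^sub>0 \<union> I 1) = card I\<^sub>0 + card (I 1)"
    using bij_betw_same_card[OF assms(11)[OF one]] assms(7) dcard by simp
  then have "I\<^sub>0 \<inter> I 1 = {}" using card_Un_Int[OF fin] fin by simp
  interpret elastoplastic_face E I\<^sub>0 "I 1" "e 1"
    using sys assms(3,4,6,8) assms(11)[OF one] \<open>I\<^sub>0 \<inter> I 1 = {}\<close> dcard by unfold_locales auto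
  have F: "F_set E I\<^sub>0 I M = face" by (rule F_set_eq_face[OF assms(10)])
  have I_image: "I ` {1..M} = sign_changes (I 1)" using assms(10) by (rule bij_betw_imp_surj_on)
  have sub: "face \<subseteq> C_set E"
  proof (rule face_subset_C)
    fix J' j assume J': "J' \<in> sign_changes (I 1)" and j: "j \<notin> range jx"
    obtain i where i: "i \<in> {1..M}" "I i = J'" using J' unfolding I_image[symmetric] by (metis imageE)
    have "snd ` (I\<^sub>0 \<union> I 1) \<subseteq> range jx"
      unfolding bij_betw_imp_surj_on[OF enum, symmetric] by (simp add: image_image)
    \<comment> \<open>Sign changes keep the spring, so a spring outside \<open>range jx\<close>
      occurs in no family and falls under the strict limits at the vertices.\<close>
    moreover have "snd ` (\<lambda>(\<alpha>, j). (- \<alpha>, j)) ` I 1 = snd ` I 1"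
      by (simp add: image_image case_prod_unfold)
    moreover have "I\<^sub>0 \<union> (\<Union>k\<in>{1..M}. I k) = I\<^sub>0 \<union> I 1 \<union> (\<lambda>(\<alpha>, j). (- \<alpha>, j)) ` I 1"
      using I_image Union_sign_changes[of "I 1"] by auto
    ultimately have "snd ` (I\<^sub>0 \<union> (\<Union>k\<in>{1..M}. I k)) \<subseteq> range jx"
      by (simp only: image_Un) blast
    then have "j \<notin> snd ` (I\<^sub>0 \<union> (\<Union>k\<in>{1..M}. I k))" using j by blast
    from assms(14)[OF i(1) this] show "c_minus E $ j \<le> a_diag E $ j * y_star E I\<^sub>0 J' $ j \<and>
        a_diag E $ j * y_star E I\<^sub>0 J' $ j \<le> c_plus E $ j"
      by (simp add: i(2))
  qed
  \<comment> \<open>\<open>smax\<close> dominates the norm of the projection for the family whose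
    coordinates describe the face.\<close>
  have smax_ge: "sqrt (sigma_max E I\<^sub>0 (e 1)) \<le> smax" unfolding smax using one by (intro Max_ge) auto
  then have "smax > 0" using sigma_max_ge_1 by linarith
  define \<epsilon> where "\<epsilon> = \<epsilon>\<^sub>0 / smax"
  have "\<epsilon> > 0" using \<open>smax > 0\<close> assms(15) by (simp add: \<epsilon>_def)
  have incl: "AE t in lebesgue. t \<in> {0..\<tau>} \<longrightarrow> load E differentiable (at t) \<and>
      (\<forall>\<zeta>\<in>face. \<forall>v\<in>ball_A E \<epsilon> \<inter> normal_cone_A E face \<zeta>.
        lift (deriv (load E) t *\<^sub>R axis None 1) + v \<in> normal_cone_A E (C_set E) \<zeta>)"
    using assms(13,16)
  proof eventually_elim
    case (elim t)
    show ?case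
    proof (intro impI conjI ballI)
      assume t: "t \<in> {0..\<tau>}"
      with elim show diff: "load E differentiable (at t)" by blast
      fix \<zeta> v assume \<zeta>: "\<zeta> \<in> face" and v: "v \<in> ball_A E \<epsilon> \<inter> normal_cone_A E face \<zeta>"
      let ?w = "lift (deriv (load E) t *\<^sub>R axis None 1)"
      have "if e 1 k \<in> I\<^sub>0 then al k * coord ?w $ k \<ge> 0 else coord ?w $ k = 0" for k
        by (rule coord_lift_cone) (use elim t in blast)
      then have cone: "e 1 k \<in> I\<^sub>0 \<Longrightarrow> al k * coord ?w $ k \<ge> 0" "e 1 k \<notin> I\<^sub>0 \<Longrightarrow> coord ?w $ k = 0" for k
        by presburger+
      \<comment> \<open>Thus \<open>?w\<close> is \<open>- c'\<close>, the vector whose distances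
        enter \<open>eps_bar\<close>.\<close>
      have "vector_derivative (c_shift E) (at t) = - ?w"
        using c_shift_has_vector_derivative[OF diff] by (rule vector_derivative_at)
      then have "\<epsilon>\<^sub>0 \<le> Min ((\<lambda>p. dist_A E ?w (span ((\<lambda>(\<alpha>, j). n_vec E j) ` (I\<^sub>0 - {p})))) ` I\<^sub>0)"
        using elim t by (simp add: eps_bar_def)
      then have dist: "\<epsilon>\<^sub>0 \<le> dist_A E ?w (span ((\<lambda>(\<alpha>, j). n_vec E j) ` (I\<^sub>0 - {p})))" if "p \<in> I\<^sub>0" for p
        using that fin(1) assms(4) by simp
      \<comment> \<open>The quotient \<open>\<epsilon>\<^sub>0 / smax\<close> is made for this: the
        \<open>I\<^sub>0\<close> part of any \<open>v\<close> in the ball has norm at most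
        \<open>\<epsilon>\<^sub>0\<close>, the lower bound for those distances.\<close>
      have "norm_A E (L_mat E I\<^sub>0 (e 1) *v v) \<le> sqrt (sigma_max E I\<^sub>0 (e 1)) * norm_A E v"
        by (rule norm_A_L_mat_le)
      also have "\<dots> \<le> smax * \<epsilon>"
        using v smax_ge \<open>smax > 0\<close> norm_A_nonneg by (intro mult_mono) (auto simp: ball_A_def)
      also have "\<dots> = \<epsilon>\<^sub>0" using \<open>smax > 0\<close> by (simp add: \<epsilon>_def)
      finally have L: "norm_A E (L_mat E I\<^sub>0 (e 1) *v v) \<le> \<epsilon>\<^sub>0" .
      show "?w + v \<in> normal_cone_A E (C_set E) \<zeta>"
      proof (rule shifted_normal_cone[where \<epsilon> = \<epsilon>\<^sub>0])
        show "v \<in> normal_cone_A E face \<zeta>" using v by blast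
      qed (fact lift_in_V cone dist L assms(15) \<zeta> sub)+
    qed
  qed
  have "AE t in lebesgue. t \<in> {0..\<tau>} \<longrightarrow>
      (\<forall>y\<in>F_set E I\<^sub>0 I M.
         (\<lambda>x. - vector_derivative (c_shift E) (at t) + x) `
           (ball_A E (\<epsilon>\<^sub>0 / smax) \<inter> normal_cone_A E (F_set E I\<^sub>0 I M) y)
         \<subseteq> normal_cone_A E (C_set E) y)"
    using incl
  proof eventually_elim
    case (elim t)
    show ?case
    proof (intro impI ballI image_subsetI)
      fix y x assume t: "t \<in> {0..\<tau>}" and y: "y \<in> F_set E I\<^sub>0 I M"
        and x: "x \<in> ball_A E (\<epsilon>\<^sub>0 / smax) \<inter> normal_cone_A E (F_set E I\<^sub>0 I M) y"
      have "load E differentiable (at t)" using elim t by blast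
      then have "vector_derivative (c_shift E) (at t) = - lift (deriv (load E) t *\<^sub>R axis None 1)"
        by (intro vector_derivative_at c_shift_has_vector_derivative)
      then show "- vector_derivative (c_shift E) (at t) + x \<in> normal_cone_A E (C_set E) y"
        using elim t y x by (simp add: F \<epsilon>_def)
    qed
  qed
  moreover have "y \<tau> \<in> moved E (F_set E I\<^sub>0 I M) \<tau> \<and>
      stress E y \<tau> \<in> convex hull ((\<lambda>i. A_mat E *v y_star E I\<^sub>0 (I i)) ` {1..M})"
    if y: "sweeping_solution E y" for y
  proof
    have "norm_A E (matrix_inv (A_mat E) *v c_plus E - matrix_inv (A_mat E) *v c_minus E) \<le> \<epsilon> * \<tau>"
      using assms(18) \<open>smax > 0\<close> assms(15) by (simp add: \<epsilon>_def field_simps)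
    then have arrived: "y \<tau> - c_shift E \<tau> \<in> face"
      using \<open>\<epsilon> > 0\<close> assms(12) by (intro arrival_in_face[OF _ _ sub incl _ y]) auto
    then have "y \<tau> - c_shift E \<tau> + c_shift E \<tau> \<in> moved E face \<tau>" unfolding moved_def by blast
    then show "y \<tau> \<in> moved E (F_set E I\<^sub>0 I M) \<tau>" by (simp add: F)
    \<comment> \<open>The stress is \<open>A_mat E\<close> applied to a point of the face, and a
      linear map takes the hull of the vertices to the hull of their images.\<close>
    have "stress E y \<tau> \<in> (*v) (A_mat E) ` (convex hull (y_star E I\<^sub>0 ` I ` {1..M}))"
      unfolding stress_def I_image using arrived face_subset_convex_hull by blast
    then show "stress E y \<tau> \<in> convex hull ((\<lambda>i. A_mat E *v y_star E I\<^sub>0 (I i)) ` {1..M})"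
      by (simp add: convex_hull_linear_image matrix_vector_mul_linear image_image)
  qed
  ultimately show ?thesis by blast
qed

end
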